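(* Suppose $\mu$ and $\mu'$ are shift-invariant Borel probability measures on $\Omega_\pm=\{\pm1\}^{\mathbb Z}$, and let $$p=\int_{\Omega_\pm}\omega_0\,d\mu(\omega)\quad\text{and}\quad q=\int_{\Omega_\pm}\omega'_0\,d\mu'(\omega').$$ Let $e$ be an edge of the tiling of the plane by unit squares centered at the integer points. Then the $\mu\times\mu'$-measure of the set of pairs $(\omega,\omega')\in\Omega_\pm\times\Omega_\pm$ such that the curve of the Truchet tiling $[\tau_{\omega,\omega'}]$ through $e$ is bi-infinite is at least $\max\{|p|,|q|\}$.
   Context: $\Omega_\pm=\{\pm1\}^{\mathbb Z}$ has the product topology and the shift map $\sigma(\omega)_n=\omega_{n+1}$; a Borel measure $\mu$ is shift-invariant if $\mu\circ\sigma^{-1}=\mu$. Truchet tiles: both tiles are $1\times1$ axis-parallel squares decorated with two disjoint arcs (quarter circles centered at two opposite corners of the square), each joining the midpoints of two adjacent edges. The tile $T_{1}$ has one arc joining the midpoints of the left and top edges and one arc joining the midpoints of the bottom and right edges; the tile $T_{-1}$ has one arc joining the midpoints of the left and bottom edges and one arc joining the midpoints of the top and right edges. For $\tau:\mathbb Z^2\to\{\pm1\}$, the Truchet tiling $[\tau]$ places a copy of $T_{\tau(m,n)}$ centered at $(m,n)$ for each $(m,n)\in\mathbb Z^2$. The arcs join to form a disjoint collection of simple curves in the plane, called the curves of the tiling; each is either closed or bi-infinite. The curve through an edge $e$ of the square tiling is the one passing through the midpoint of $e$. For $\omega,\omega'\in\Omega_\pm$, $\tau_{\omega,\omega'}:\mathbb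 Z^2\to\{\pm1\}$ is defined by $\tau_{\omega,\omega'}(m,n)=\omega_m\omega'_n$. *)

theory Defs
  imports "HOL-Probability.Probability"
begin

definition pm_topology :: "(int \<Rightarrow> int) topology" where
  "pm_topology = product_topology (\<lambda>_. discrete_topology {-1, 1}) UNIV"

definition Omega_pm :: "(int \<Rightarrow> int) set" where
  "Omega_pm = {\<omega>. \<forall>n. \<omega> n \<in> {-1, 1}}"

definition borel_pm :: "(int \<Rightarrow> int) measure" where
  "borel_pm = sigma Omega_pm {U. openin pm_topology U}"

definition shift :: "(int \<Rightarrow> int) \<Rightarrow> (int \<Rightarrow> int)" where
  "shift \<omega> = (\<lambda>n. \<omega> (n + 1))"

definition shift_invariant :: "(int \<Rightarrow> int) measure \<Rightarrow> bool" where
  "shift_invariant \<mu> \<longleftrightarrow> distr \<mu> \<mu> shift = \<mu>"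

definition borel_prob_pm :: "(int \<Rightarrow> int) measure \<Rightarrow> bool" where
  "borel_prob_pm \<mu> \<longleftrightarrow> sets \<mu> = sets borel_pm \<and> prob_space \<mu>"

text \<open>The square is centered at the origin; the quarter circle around a corner
  joins the midpoints of the two edges meeting in that corner.\<close>

definition unit_square :: "(real \<times> real) set" where
  "unit_square = {-1/2..1/2} \<times> {-1/2..1/2}"

definition corner_arc :: "real \<times> real \<Rightarrow> (real \<times> real) set" where
  "corner_arc c = sphere c (1/2) \<inter> unit_square"

definition truchet_tile :: "int \<Rightarrow> (real \<times> real) set set" where
  "truchet_tile s =
     (if s = 1 then {corner_arc (-1/2, 1/2), corner_arc (1/2, -1/2)}
      else {corner_arc (-1/2, -1/2), corner_arc (1/2, 1/2)})"

definition truchet_arcs :: "(int \<times> int \<Rightarrow> int) \<Rightarrow> (real \<times> real) set set" where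
  "truchet_arcs \<tau> =
     {(+) (real_of_int m, real_of_int n) ` A | m n A. A \<in> truchet_tile (\<tau> (m, n))}"

definition truchet_curves :: "(int \<times> int \<Rightarrow> int) \<Rightarrow> (real \<times> real) set set" where
  "truchet_curves \<tau> = components (\<Union> (truchet_arcs \<tau>))"

text \<open>The bottom and left edges of all squares exhaust the edges of the square tiling.\<close>

definition tiling_edges :: "(real \<times> real) set set" where
  "tiling_edges =
     {closed_segment (real_of_int m - 1/2, real_of_int n - 1/2)
                     (real_of_int m + 1/2, real_of_int n - 1/2) | m n. True} \<union>
     {closed_segment (real_of_int m - 1/2, real_of_int n - 1/2)
                     (real_of_int m - 1/2, real_of_int n + 1/2) | m n. True}"

definition edge_midpoint :: "(real \<times> real) set \<Rightarrow> real \<times> real" where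
  "edge_midpoint e = (THE x. \<exists>a b. e = closed_segment a b \<and> x = midpoint a b)"

definition curve_through ::
    "(int \<times> int \<Rightarrow> int) \<Rightarrow> (real \<times> real) set \<Rightarrow> (real \<times> real) set" where
  "curve_through \<tau> e = (THE C. C \<in> truchet_curves \<tau> \<and> edge_midpoint e \<in> C)"

definition bi_infinite_curve :: "(real \<times> real) set \<Rightarrow> bool" where
  "bi_infinite_curve C \<longleftrightarrow>
     (\<exists>\<gamma> :: real \<Rightarrow> real \<times> real.
        continuous_on UNIV \<gamma> \<and> inj \<gamma> \<and> range \<gamma> = C \<and>
        filterlim \<gamma> at_infinity at_top \<and> filterlim \<gamma> at_infinity at_bot)"

definition tau :: "(int \<Rightarrow> int) \<Rightarrow> (int \<Rightarrow> int) \<Rightarrow> int \<times> int \<Rightarrow> int" where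
  "tau \<omega> \<omega>' = (\<lambda>(m, n). \<omega> m * \<omega>' n)"

definition bi_infinite_pairs :: "(real \<times> real) set \<Rightarrow> ((int \<Rightarrow> int) \<times> (int \<Rightarrow> int)) set" where
  "bi_infinite_pairs e =
     {(\<omega>, \<omega>'). \<omega> \<in> Omega_pm \<and> \<omega>' \<in> Omega_pm \<and>
        bi_infinite_curve (curve_through (tau \<omega> \<omega>') e)}"

lemma topspace_pm_topology: "topspace pm_topology = Omega_pm"
  by (auto simp: pm_topology_def Omega_pm_def)

lemma sets_borel_pm: "sets borel_pm = sigma_sets Omega_pm {U. openin pm_topology U}"
  unfolding borel_pm_def
  by (rule sets_measure_of) (use openin_subset topspace_pm_topology in blast)

lemma space_borel_pm: "space borel_pm = Omega_pm"
  unfolding borel_pm_def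
  by (rule space_measure_of) (use openin_subset topspace_pm_topology in blast)

lemma coordinate_measurable: "(\<lambda>\<omega>. \<omega> n) \<in> measurable borel_pm (count_space {-1, 1})"
proof -
  have c: "continuous_map pm_topology (discrete_topology {-1, 1}) (\<lambda>\<omega>. \<omega> n)"
    unfolding pm_topology_def by (rule continuous_map_product_projection) simp
  show ?thesis
  proof (rule measurableI)
    fix \<omega> assume "\<omega> \<in> space borel_pm"
    then show "\<omega> n \<in> space (count_space {-1, 1})"
      by (auto simp: space_borel_pm Omega_pm_def)
  next
    fix A assume "A \<in> sets (count_space {-1, 1::int})"
    then have "openin pm_topology {\<omega> \<in> topspace pm_topology. \<omega> n \<in> A}"
      by (intro openin_continuous_map_preimage[OF c]) simp
    moreover have "(\<lambda>\<omega>. \<omega> n) -` A \<inter> space borel_pm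
                     = {\<omega> \<in> topspace pm_topology. \<omega> n \<in> A}"
      by (auto simp: space_borel_pm topspace_pm_topology)
    ultimately show "(\<lambda>\<omega>. \<omega> n) -` A \<inter> space borel_pm \<in> sets borel_pm"
      by (auto simp: sets_borel_pm)
  qed
qed

lemma shift_measurable: "shift \<in> measurable borel_pm borel_pm"
proof -
  have c: "continuous_map pm_topology pm_topology shift"
    unfolding pm_topology_def shift_def continuous_map_componentwise_UNIV
    by (intro allI continuous_map_product_projection) simp
  show ?thesis
  proof (rule measurable_sigma_sets[OF sets_borel_pm])
    show "{U. openin pm_topology U} \<subseteq> Pow Omega_pm"
      using openin_subset topspace_pm_topology by blast
    show "shift \<in> space borel_pm \<rightarrow> Omega_pm"
      by (auto simp: space_borel_pm Omega_pm_def shift_def)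
    fix U assume "U \<in> {U. openin pm_topology U}"
    then have "openin pm_topology {\<omega> \<in> topspace pm_topology. shift \<omega> \<in> U}"
      by (intro openin_continuous_map_preimage[OF c]) simp
    moreover have "shift -` U \<inter> space borel_pm
                     = {\<omega> \<in> topspace pm_topology. shift \<omega> \<in> U}"
      by (auto simp: space_borel_pm topspace_pm_topology)
    ultimately show "shift -` U \<inter> space borel_pm \<in> sets borel_pm"
      by (auto simp: sets_borel_pm)
  qed
qed

lemma edge_midpoint_closed_segment: "edge_midpoint (closed_segment a b) = midpoint a b"
  unfolding edge_midpoint_def
proof (rule the_equality)
  fix x assume "\<exists>c d. closed_segment a b = closed_segment c d \<and> x = midpoint c d"
  then obtain c d where "closed_segment a b = closed_segment c d" "x = midpoint c d" by blast
  then have "{a, b} = {c, d}" by (simp add: closed_segment_eq)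
  with \<open>x = midpoint c d\<close> show "x = midpoint a b"
    by (metis doubleton_eq_iff midpoint_sym)
qed blast

lemma edge_midpoint_in_arcs:
  assumes "e \<in> tiling_edges"
  shows "edge_midpoint e \<in> \<Union> (truchet_arcs \<tau>)"
proof -
  have pt: "(real_of_int m + x, real_of_int n + y) \<in> \<Union> (truchet_arcs \<tau>)"
    if "A \<in> truchet_tile (\<tau> (m, n))" "(x, y) \<in> A" for m n x y A
  proof -
    have "(real_of_int m + x, real_of_int n + y) \<in> (+) (real_of_int m, real_of_int n) ` A"
      using that(2) by (force simp: image_iff)
    then show ?thesis using that(1) unfolding truchet_arcs_def by blast
  qed
  have bot: "\<exists>A \<in> truchet_tile s. (0, -1/2) \<in> A" for s
    by (auto simp: truchet_tile_def corner_arc_def unit_square_def dist_prod_def dist_real_def)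
  have left: "\<exists>A \<in> truchet_tile s. (-1/2, 0) \<in> A" for s
    by (auto simp: truchet_tile_def corner_arc_def unit_square_def dist_prod_def dist_real_def)
  from assms consider m n where "edge_midpoint e = (real_of_int m + 0, real_of_int n + -1/2)"
    | m n where "edge_midpoint e = (real_of_int m + -1/2, real_of_int n + 0)"
    by (auto simp: tiling_edges_def edge_midpoint_closed_segment midpoint_def)
  then show ?thesis
    by cases (metis bot left pt)+
qed

lemma curve_through_eq:
  assumes "e \<in> tiling_edges"
  shows "curve_through \<tau> e =
    connected_component_set (\<Union> (truchet_arcs \<tau>)) (edge_midpoint e)"
  unfolding curve_through_def truchet_curves_def
proof (rule the_equality)
  show "connected_component_set (\<Union> (truchet_arcs \<tau>)) (edge_midpoint e)
      \<in> components (\<Union> (truchet_arcs \<tau>)) \<and>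
    edge_midpoint e \<in> connected_component_set (\<Union> (truchet_arcs \<tau>)) (edge_midpoint e)"
    using edge_midpoint_in_arcs[OF assms] by (auto intro: componentsI)
next
  fix C assume "C \<in> components (\<Union> (truchet_arcs \<tau>)) \<and> edge_midpoint e \<in> C"
  then show "C = connected_component_set (\<Union> (truchet_arcs \<tau>)) (edge_midpoint e)"
    by (metis componentsE connected_component_eq)
qed

end

theory Submission
  imports Defs
begin

text \<open>In the tiling given by \<open>w\<close> and \<open>u\<close>, orient row \<open>n\<close> in the horizontal direction \<open>u n\<close> and column
  \<open>m\<close> in the vertical direction \<open>w m\<close>. The arcs of the tiles are then exactly the turns between the
  oriented row and column of a tile, so every curve can be traversed consistently with these
  orientations, alternating vertical and horizontal unit steps. Recentring after a vertical and a
  horizontal step is a composition of two skew products over shifts, hence preserves the product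
  measure. On the invariant set \<open>C\<close> where the curve closes up, the sums of the vertical steps \<open>w 0\<close>
  along the orbit are bounded, so by dominated convergence the integral of \<open>w 0\<close> over \<open>C\<close> vanishes,
  and \<open>\<bar>p\<bar>\<close> is at most the measure of the complement of \<open>C\<close>. The horizontal steps give the
  same bound for \<open>\<bar>q\<bar>\<close>.\<close>

section \<open>Oriented arcs\<close>

text \<open>The triple \<open>(m, n, b)\<close> stands for the arc of the tile at \<open>(m, n)\<close> that is entered horizontally
  if \<open>b\<close> holds and vertically otherwise.\<close>

fun next_arc :: "(int \<Rightarrow> int) \<Rightarrow> (int \<Rightarrow> int) \<Rightarrow> int \<times> int \<times> bool \<Rightarrow> int \<times> int \<times> bool" where
  "next_arc w u (m, n, True) = (m, n + w m, False)"
| "next_arc w u (m, n, False) = (m + u n, n, True)"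

fun prev_arc :: "(int \<Rightarrow> int) \<Rightarrow> (int \<Rightarrow> int) \<Rightarrow> int \<times> int \<times> bool \<Rightarrow> int \<times> int \<times> bool" where
  "prev_arc w u (m, n, True) = (m - u n, n, False)"
| "prev_arc w u (m, n, False) = (m, n - w m, True)"

lemma next_arc_prev_arc [simp]: "next_arc w u (prev_arc w u a) = a"
  by (cases "(w, u, a)" rule: prev_arc.cases) auto

lemma prev_arc_next_arc [simp]: "prev_arc w u (next_arc w u a) = a"
  by (cases "(w, u, a)" rule: next_arc.cases) auto

text \<open>The parametrisation of the quarter circle by \<open>(1 - s, 1 - sqrt (1 - s\<^sup>2))\<close>, in units of half a
  tile and reflected according to the orientations of the row and the column.\<close>

fun arc_pt :: "(int \<Rightarrow> int) \<Rightarrow> (int \<Rightarrow> int) \<Rightarrow> int \<times> int \<times> bool \<Rightarrow> real \<Rightarrow> real \<times> real" where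
  "arc_pt w u (m, n, True) s =
     (m - u n / 2 * (1 - s), n + w m / 2 * (1 - sqrt (1 - s\<^sup>2)))"
| "arc_pt w u (m, n, False) s =
     (m + u n / 2 * (1 - sqrt (1 - s\<^sup>2)), n - w m / 2 * (1 - s))"

definition node_arc ::
    "(int \<Rightarrow> int) \<Rightarrow> (int \<Rightarrow> int) \<Rightarrow> int \<times> int \<times> bool \<Rightarrow> (real \<times> real) set" where
  "node_arc w u a = arc_pt w u a ` {0..1}"

lemma continuous_on_arc_pt: "continuous_on X (arc_pt w u a)"
  by (cases "(w, u, a, 0::real)" rule: arc_pt.cases) (auto intro!: continuous_intros)

text \<open>Parameter \<open>1\<close> is the midpoint of the edge through which the arc leaves its
  tile, and the next arc enters the adjacent tile through that same edge.\<close>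

lemma arc_pt_next_arc: "arc_pt w u (next_arc w u a) 0 = arc_pt w u a 1"
  by (cases "(w, u, a)" rule: next_arc.cases) (auto simp: field_simps)

lemma Omega_pm_cases:
  assumes "w \<in> Omega_pm"
  obtains "w n = 1" | "w n = -1"
  using assms by (auto simp: Omega_pm_def)

lemma sqrt_bounds:
  assumes "0 < s" "s < (1::real)"
  shows "0 < sqrt (1 - s\<^sup>2)" "sqrt (1 - s\<^sup>2) < 1"
  using assms by (auto simp: power_less_one_iff abs_square_less_1)

lemma arc_pt_near:
  assumes "w \<in> Omega_pm" "u \<in> Omega_pm" "s \<in> {0..1}"
  shows "\<bar>fst (arc_pt w u (m, n, b) s) - m\<bar> \<le> 1/2" "\<bar>snd (arc_pt w u (m, n, b) s) - n\<bar> \<le> 1/2"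
proof -
  have "0 \<le> sqrt (1 - s\<^sup>2)" "sqrt (1 - s\<^sup>2) \<le> 1"
    using assms(3) by (auto simp: power_le_one)
  then show "\<bar>fst (arc_pt w u (m, n, b) s) - m\<bar> \<le> 1/2" "\<bar>snd (arc_pt w u (m, n, b) s) - n\<bar> \<le> 1/2"
    using assms(3)
    by (cases b; cases rule: Omega_pm_cases[OF assms(1), of m];
        cases rule: Omega_pm_cases[OF assms(2), of n]; simp)+
qed

lemma arc_pt_interior:
  assumes "w \<in> Omega_pm" "u \<in> Omega_pm" "0 < s" "s < 1"
  shows "\<bar>fst (arc_pt w u (m, n, b) s) - m\<bar> < 1/2" "\<bar>snd (arc_pt w u (m, n, b) s) - n\<bar> < 1/2"
  using assms(3,4) sqrt_bounds[OF assms(3,4)]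
    by (cases b; cases rule: Omega_pm_cases[OF assms(1), of m];
        cases rule: Omega_pm_cases[OF assms(2), of n]; simp)+

text \<open>Start points of arcs have a half-integer coordinate, which keeps distance at least 1/2
  from every integer. The factor 2 matches the form into which the simplifier brings a bound by
  \<open>1/2\<close>.\<close>

lemma half_integer:
  fixes m k :: int
  shows "\<not> \<bar>real_of_int m + 1/2 - real_of_int k\<bar> * 2 < 1"
    and "\<not> \<bar>real_of_int m - 1/2 - real_of_int k\<bar> * 2 < 1"
proof -
  show *: "\<not> \<bar>real_of_int m + 1/2 - real_of_int k\<bar> * 2 < 1" for m
  proof
    assume "\<bar>real_of_int m + 1/2 - real_of_int k\<bar> * 2 < 1"
    then have "real_of_int m < real_of_int k" "real_of_int k < real_of_int (m + 1)"
      by (auto simp: abs_if split: if_splits)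
    then show False by (simp only: of_int_less_iff)
  qed
  show "\<not> \<bar>real_of_int m - 1/2 - real_of_int k\<bar> * 2 < 1"
    using *[of "m - 1"] by simp
qed

text \<open>Inner points of an arc lie in an open tile, whereas a start point lies on an edge of the
  square tiling and so in no open tile.\<close>

lemma arc_pt_interior_neq_start:
  assumes "w \<in> Omega_pm" "u \<in> Omega_pm" "0 < s" "s < 1"
  shows "arc_pt w u a s \<noteq> arc_pt w u b 0"
proof
  assume eq: "arc_pt w u a s = arc_pt w u b 0"
  obtain m n c where a: "a = (m, n, c)" by (cases a) auto
  obtain m' n' c' where b: "b = (m', n', c')" by (cases b) auto
  show False
    using arc_pt_interior[OF assms, of m n c] unfolding eq[unfolded a b]
    by (cases c'; cases rule: Omega_pm_cases[OF assms(1), of m'];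
        cases rule: Omega_pm_cases[OF assms(2), of n']) (simp_all add: half_integer)
qed

text \<open>The parameter range is half-open so that an edge midpoint counts only as the start of an
  arc. It starts a single arc because both tiles at an edge prescribe the same crossing
  direction.\<close>

lemma arc_pt_inject:
  assumes "w \<in> Omega_pm" "u \<in> Omega_pm" "s \<in> {0..<1}" "t \<in> {0..<1}"
    and eq: "arc_pt w u a s = arc_pt w u b t"
  shows "a = b \<and> s = t"
proof -
  obtain m n c where a: "a = (m, n, c)" by (cases a) auto
  obtain m' n' c' where b: "b = (m', n', c')" by (cases b) auto
  have "s = 0 \<longleftrightarrow> t = 0"
    using arc_pt_interior_neq_start[OF assms(1,2)] assms(3-5)
    by (metis atLeastLessThan_iff order_le_less)
  then consider "s = 0" "t = 0" | "0 < s" "0 < t" using assms(3,4) by fastforce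
  then show ?thesis
  proof cases
    case 1
    have half: "real_of_int i + 1/2 \<noteq> real_of_int j" "real_of_int i - 1/2 \<noteq> real_of_int j" for i j
      using half_integer[of i j] by auto
    note start = eq[unfolded a b 1]
    show ?thesis
    proof (cases "c = c'")
      case True
      with start 1 show ?thesis by (cases c) (auto simp: a b)
    next
      case False
      \<comment> \<open>A horizontal entry has a half-integer first coordinate, a vertical entry an
        integer one.\<close>
      with start show ?thesis
        by (cases c; cases rule: Omega_pm_cases[OF assms(2), of n];
            cases rule: Omega_pm_cases[OF assms(2), of n'])
           (simp_all add: half half[THEN not_sym])
    qed
  next
    case 2
    have st: "s < 1" "t < 1" using assms by auto
    have near: "i = j" if "\<bar>x - real_of_int i\<bar> < 1/2" "\<bar>x - real_of_int j\<bar> < 1/2" for x i j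
    proof -
      have "\<bar>real_of_int i - real_of_int j\<bar> < 1" using that by linarith
      then show ?thesis by linarith
    qed
    have "m = m'" "n = n'"
      using arc_pt_interior[OF assms(1,2) 2(1) st(1), of m n c]
        arc_pt_interior[OF assms(1,2) 2(2) st(2), of m' n' c'] 
      unfolding eq[unfolded a b] by (blast intro: near)+
    \<comment> \<open>For inner parameters the first coordinates of the two arcs of a tile lie
      strictly on opposite sides of \<open>m\<close>. Within one arc, the coordinate that is linear
      in the parameter determines it.\<close>
    define x where "x = sqrt (1 - s\<^sup>2)"
    define y where "y = sqrt (1 - t\<^sup>2)"
    have "x < 1" "y < 1"
      unfolding x_def y_def using sqrt_bounds 2 st by blast+
    then show ?thesis
      using eq 2 st \<open>m = m'\<close> \<open>n = n'\<close> unfolding a b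
      by (cases c; cases c'; cases rule: Omega_pm_cases[OF assms(1), of m];
          cases rule: Omega_pm_cases[OF assms(2), of n])
         (auto simp: x_def[symmetric] y_def[symmetric])
  qed
qed

section \<open>Identification with the quarter circles of the tiles\<close>

lemma corner_arc_param:
  assumes "a \<in> {-1, 1::int}" "b \<in> {-1, 1::int}"
  shows "(\<lambda>s. (a / 2 * (1 - s), b / 2 * (1 - sqrt (1 - s\<^sup>2)))) ` {0..1} = corner_arc (a / 2, b / 2)"
    and "(\<lambda>s. (a / 2 * (1 - sqrt (1 - s\<^sup>2)), b / 2 * (1 - s))) ` {0..1} = corner_arc (a / 2, b / 2)"
proof -
  have ab: "(real_of_int a)\<^sup>2 = 1" "(real_of_int b)\<^sup>2 = 1" using assms by auto
  \<comment> \<open>In the coordinates \<open>s\<close> and \<open>t\<close> the corner is the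
    origin, the square becomes \<open>{0..2}\<close> in each coordinate and the arc lies on the unit
    circle. The two parametrisations solve the circle equation for \<open>t\<close> or for
    \<open>s\<close>.\<close>
  have iff: "(a / 2 * (1 - s), b / 2 * (1 - t)) \<in> corner_arc (a / 2, b / 2) \<longleftrightarrow>
      s \<in> {0..2} \<and> t \<in> {0..2} \<and> s\<^sup>2 + t\<^sup>2 = 1" for s t
  proof -
    have "dist (a / 2, b / 2) (a / 2 * (1 - s), b / 2 * (1 - t)) = sqrt ((a / 2 * s)\<^sup>2 + (b / 2 * t)\<^sup>2)"
      by (simp add: dist_prod_def dist_real_def field_simps)
    also have "\<dots> = sqrt (s\<^sup>2 + t\<^sup>2) / 2"
      by (simp add: power_mult_distrib power_divide ab add_divide_distrib[symmetric] real_sqrt_divide)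
    finally show ?thesis
      using assms by (auto simp: corner_arc_def unit_square_def)
  qed
  have "\<exists>s t. z = (a / 2 * (1 - s), b / 2 * (1 - t))" for z
    using assms by (intro exI[of _ "1 - 2 * fst z / a"] exI[of _ "1 - 2 * snd z / b"]) (cases z, auto)
  note rep = this
  have eqs: "t = sqrt (1 - s\<^sup>2)" "s = sqrt (1 - t\<^sup>2)" "s \<le> 1" "t \<le> 1"
    if "s \<in> {0..2}" "t \<in> {0..2}" "s\<^sup>2 + t\<^sup>2 = 1" for s t :: real
  proof -
    have st: "1 - s\<^sup>2 = t\<^sup>2" "1 - t\<^sup>2 = s\<^sup>2" using that(3) by auto
    show "t = sqrt (1 - s\<^sup>2)" "s = sqrt (1 - t\<^sup>2)" using that(1,2) by (auto simp: st)
    have "s\<^sup>2 \<le> 1\<^sup>2" "t\<^sup>2 \<le> 1\<^sup>2" using st by (metis diff_ge_0_iff_ge one_power2 zero_le_power2)+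
    then show "s \<le> 1" "t \<le> 1" by (auto intro: power2_le_imp_le)
  qed
  have sq: "sqrt (1 - s\<^sup>2) \<in> {0..2}" "s\<^sup>2 + (sqrt (1 - s\<^sup>2))\<^sup>2 = 1" if "s \<in> {0..1}" for s :: real
    using that order_trans[of "sqrt (1 - s\<^sup>2)" 1 2] by (auto simp: power_le_one)
  show "(\<lambda>s. (a / 2 * (1 - s), b / 2 * (1 - sqrt (1 - s\<^sup>2)))) ` {0..1} = corner_arc (a / 2, b / 2)"
  proof (intro equalityI subsetI)
    fix z assume z: "z \<in> corner_arc (a / 2, b / 2)"
    obtain s t where st: "z = (a / 2 * (1 - s), b / 2 * (1 - t))" using rep by blast
    with z have *: "s \<in> {0..2}" "t \<in> {0..2}" "s\<^sup>2 + t\<^sup>2 = 1" by (simp_all only: iff)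
    show "z \<in> (\<lambda>s. (a / 2 * (1 - s), b / 2 * (1 - sqrt (1 - s\<^sup>2)))) ` {0..1}"
      using eqs(1,3)[OF *] * by (intro image_eqI[of _ _ s]) (auto simp: st)
  next
    fix z assume "z \<in> (\<lambda>s. (a / 2 * (1 - s), b / 2 * (1 - sqrt (1 - s\<^sup>2)))) ` {0..1}"
    then obtain s where s: "s \<in> {0..1}" "z = (a / 2 * (1 - s), b / 2 * (1 - sqrt (1 - s\<^sup>2)))" by blast
    show "z \<in> corner_arc (a / 2, b / 2)"
      unfolding s(2) iff using s(1) sq[OF s(1)] by simp
  qed
  show "(\<lambda>s. (a / 2 * (1 - sqrt (1 - s\<^sup>2)), b / 2 * (1 - s))) ` {0..1} = corner_arc (a / 2, b / 2)"
  proof (intro equalityI subsetI)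
    fix z assume z: "z \<in> corner_arc (a / 2, b / 2)"
    obtain s t where st: "z = (a / 2 * (1 - s), b / 2 * (1 - t))" using rep by blast
    with z have *: "s \<in> {0..2}" "t \<in> {0..2}" "s\<^sup>2 + t\<^sup>2 = 1" by (simp_all only: iff)
    show "z \<in> (\<lambda>s. (a / 2 * (1 - sqrt (1 - s\<^sup>2)), b / 2 * (1 - s))) ` {0..1}"
      using eqs(2,4)[OF *] * by (intro image_eqI[of _ _ t]) (auto simp: st)
  next
    fix z assume "z \<in> (\<lambda>s. (a / 2 * (1 - sqrt (1 - s\<^sup>2)), b / 2 * (1 - s))) ` {0..1}"
    then obtain s where s: "s \<in> {0..1}" "z = (a / 2 * (1 - sqrt (1 - s\<^sup>2)), b / 2 * (1 - s))" by blast
    show "z \<in> corner_arc (a / 2, b / 2)"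
      unfolding s(2) iff using s(1) sq[OF s(1)] by (simp add: add.commute)
  qed
qed

text \<open>An arc goes around the corner shared by its entry edge and its exit edge.\<close>

lemma node_arc_eq:
  fixes m n :: int
  assumes "w \<in> Omega_pm" "u \<in> Omega_pm"
  shows "node_arc w u (m, n, True) = (+) (real_of_int m, real_of_int n) ` corner_arc (- real_of_int (u n) / 2, w m / 2)"
    and "node_arc w u (m, n, False) = (+) (real_of_int m, real_of_int n) ` corner_arc (u n / 2, - real_of_int (w m) / 2)"
proof -
  have pm: "w m \<in> {-1, 1}" "- w m \<in> {-1, 1}" "u n \<in> {-1, 1}" "- u n \<in> {-1, 1}"
    using assms by (auto simp: Omega_pm_def)
  show "node_arc w u (m, n, True) = (+) (real_of_int m, real_of_int n) ` corner_arc (- real_of_int (u n) / 2, w m / 2)"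
    using corner_arc_param(1)[OF pm(4,1), symmetric] by (simp add: node_arc_def image_image)
  show "node_arc w u (m, n, False) = (+) (real_of_int m, real_of_int n) ` corner_arc (u n / 2, - real_of_int (w m) / 2)"
    using corner_arc_param(2)[OF pm(3,2), symmetric] by (simp add: node_arc_def image_image)
qed

text \<open>The product form of \<open>tau\<close> enters here: reversing both orientations at a
  tile only exchanges its two arcs, while reversing one of them exchanges the two types of
  tile.\<close>

lemma Union_truchet_arcs_tau:
  assumes "w \<in> Omega_pm" "u \<in> Omega_pm"
  shows "\<Union> (truchet_arcs (tau w u)) = (\<Union>a. node_arc w u a)"
proof -
  have tile: "truchet_tile (tau w u (m, n)) =
      {corner_arc (- real_of_int (u n) / 2, w m / 2), corner_arc (u n / 2, - real_of_int (w m) / 2)}" for m n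
    by (cases rule: Omega_pm_cases[OF assms(1), of m]; cases rule: Omega_pm_cases[OF assms(2), of n])
       (auto simp: truchet_tile_def tau_def)
  have "truchet_arcs (tau w u) = range (node_arc w u)"
  proof (intro equalityI subsetI)
    fix A assume "A \<in> truchet_arcs (tau w u)"
    then obtain m n where "A = node_arc w u (m, n, True) \<or> A = node_arc w u (m, n, False)"
      by (auto simp: truchet_arcs_def tile node_arc_eq[OF assms])
    then show "A \<in> range (node_arc w u)" by blast
  next
    fix A assume "A \<in> range (node_arc w u)"
    then obtain m n b where "A = node_arc w u (m, n, b)" by auto
    then show "A \<in> truchet_arcs (tau w u)"
      unfolding truchet_arcs_def by (cases b) (auto simp: tile node_arc_eq[OF assms])
  qed
  then show ?thesis by simp
qed

section \<open>Curves as orbits of arcs\<close>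

definition orb :: "(int \<Rightarrow> int) \<Rightarrow> (int \<Rightarrow> int) \<Rightarrow> int \<times> int \<times> bool \<Rightarrow> int \<Rightarrow> int \<times> int \<times> bool" where
  "orb w u a k = (if 0 \<le> k then (next_arc w u ^^ nat k) a else (prev_arc w u ^^ nat (- k)) a)"

definition periodic :: "(int \<Rightarrow> int) \<Rightarrow> (int \<Rightarrow> int) \<Rightarrow> int \<times> int \<times> bool \<Rightarrow> bool" where
  "periodic w u a \<longleftrightarrow> (\<exists>k>0. (next_arc w u ^^ k) a = a)"

lemma orb_0 [simp]: "orb w u a 0 = a"
  by (simp add: orb_def)

lemma orb_add1: "orb w u a (k + 1) = next_arc w u (orb w u a k)"
proof (cases "0 \<le> k")
  case True
  then show ?thesis by (simp add: orb_def nat_add_distrib)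
next
  case False
  then have "nat (- k) = Suc (nat (- (k + 1)))" by simp
  with False show ?thesis by (auto simp: orb_def)
qed

lemma orb_diff1: "orb w u a (k - 1) = prev_arc w u (orb w u a k)"
  using orb_add1[of w u a "k - 1"] by simp

lemma orb_add_nat: "orb w u a (k + int i) = (next_arc w u ^^ i) (orb w u a k)"
proof (induction i)
  case (Suc i)
  have "k + int (Suc i) = k + int i + 1" by simp
  with Suc show ?case by (simp only: orb_add1 funpow.simps o_apply)
qed simp

lemma next_arc_in_range_orb_iff: "next_arc w u b \<in> range (orb w u a) \<longleftrightarrow> b \<in> range (orb w u a)"
proof
  assume "next_arc w u b \<in> range (orb w u a)"
  then obtain k where "next_arc w u b = orb w u a k" by blast
  then have "b = orb w u a (k - 1)" by (metis orb_diff1 prev_arc_next_arc)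
  then show "b \<in> range (orb w u a)" by blast
next
  assume "b \<in> range (orb w u a)"
  then show "next_arc w u b \<in> range (orb w u a)" by (auto simp flip: orb_add1)
qed

lemma funpow_next_arc_fixed_iff: "(next_arc w u ^^ k) (next_arc w u a) = next_arc w u a \<longleftrightarrow> (next_arc w u ^^ k) a = a"
  by (metis funpow_swap1 prev_arc_next_arc)

lemma funpow_next_arc_orb_fixed_iff: "(next_arc w u ^^ k) (orb w u a j) = orb w u a j \<longleftrightarrow> (next_arc w u ^^ k) a = a"
proof (induction j rule: int_induct[where k = 0])
  case (step1 i)
  then show ?case by (simp add: orb_add1 funpow_next_arc_fixed_iff)
next
  case (step2 i)
  then show ?case using funpow_next_arc_fixed_iff[of k w u "orb w u a (i - 1)"]
    by (simp flip: orb_add1)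
qed simp

lemma periodic_next_arc_iff: "periodic w u (next_arc w u a) \<longleftrightarrow> periodic w u a"
  by (simp add: periodic_def funpow_next_arc_fixed_iff)

lemma inj_orb:
  assumes "\<not> periodic w u a"
  shows "inj (orb w u a)"
proof (rule linorder_injI)
  fix i j :: int assume "i < j"
  then have "j = i + int (nat (j - i))" "0 < nat (j - i)" by auto
  then show "orb w u a i \<noteq> orb w u a j"
    using assms unfolding periodic_def by (metis orb_add_nat funpow_next_arc_orb_fixed_iff)
qed

lemma finite_range_orb:
  assumes "periodic w u a"
  shows "finite (range (orb w u a))"
proof -
  obtain k where k: "k > 0" "(next_arc w u ^^ k) a = a" using assms periodic_def by blast
  have shift: "orb w u a (j + int k) = orb w u a j" for j
    using k(2) by (simp add: orb_add_nat funpow_next_arc_orb_fixed_iff)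
  \<comment> \<open>Two-sided induction reduces every index modulo the period; wrapping around
    occurs only at the ends \<open>0\<close> and \<open>int k - 1\<close>.\<close>
  have "orb w u a j \<in> orb w u a ` {0..<int k}" for j
  proof (induction j rule: int_induct[where k = 0])
    case base
    show ?case using k(1) by (intro image_eqI[of _ _ 0]) auto
  next
    case (step1 i)
    then obtain l where l: "l \<in> {0..<int k}" "orb w u a i = orb w u a l" by auto
    then have *: "orb w u a (i + 1) = orb w u a (l + 1)" by (simp add: orb_add1)
    show ?case
    proof (cases "l + 1 = int k")
      case True
      with * shift[of 0] show ?thesis using k(1) by (intro image_eqI[of _ _ 0]) auto
    next
      case False
      with * l(1) show ?thesis by (intro image_eqI[of _ _ "l + 1"]) auto
    qed
  next
    case (step2 i)
    then obtain l where l: "l \<in> {0..<int k}" "orb w u a i = orb w u a l" by auto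
    then have *: "orb w u a (i - 1) = orb w u a (l - 1)" by (simp add: orb_diff1)
    show ?case
    proof (cases "l = 0")
      case True
      with * shift[of "-1"] show ?thesis using k(1) by (intro image_eqI[of _ _ "int k - 1"]) auto
    next
      case False
      with * l(1) show ?thesis by (intro image_eqI[of _ _ "l - 1"]) auto
    qed
  qed
  then have "range (orb w u a) \<subseteq> orb w u a ` {0..<int k}" by blast
  then show ?thesis by (rule finite_subset) simp
qed

section \<open>The parametrised curve, its connected component and its ends\<close>

definition orbit_curve :: "(int \<Rightarrow> int) \<Rightarrow> (int \<Rightarrow> int) \<Rightarrow> int \<times> int \<times> bool \<Rightarrow> real \<Rightarrow> real \<times> real" where
  "orbit_curve w u a x = arc_pt w u (orb w u a \<lfloor>x\<rfloor>) (frac x)"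

text \<open>At the right end the floor already selects the next arc. Since consecutive arcs are
  glued there, the formula of the old arc remains valid, which gives continuity across
  integers.\<close>

lemma orbit_curve_on_segment:
  assumes "x \<in> {of_int k..of_int k + 1}"
  shows "orbit_curve w u a x = arc_pt w u (orb w u a k) (x - of_int k)"
proof (cases "x = of_int k + 1")
  case True
  then have "\<lfloor>x\<rfloor> = k + 1" "frac x = 0" by (simp_all add: frac_def)
  then show ?thesis using True by (simp add: orbit_curve_def orb_add1 arc_pt_next_arc)
next
  case False
  with assms have "\<lfloor>x\<rfloor> = k" by (simp add: floor_eq_iff)
  then show ?thesis by (simp add: orbit_curve_def frac_def)
qed

lemma continuous_on_orbit_curve: "continuous_on UNIV (orbit_curve w u a)"
proof -
  have seg: "continuous_on {real_of_int k..real_of_int k + 1} (orbit_curve w u a)" for k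
  proof -
    have "continuous_on {real_of_int k..real_of_int k + 1}
        (\<lambda>x. arc_pt w u (orb w u a k) (x - of_int k))"
      by (rule continuous_on_compose2[OF continuous_on_arc_pt[of UNIV]]) (auto intro!: continuous_intros)
    then show ?thesis
      by (rule continuous_on_eq) (simp add: orbit_curve_on_segment)
  qed
  have "isCont (orbit_curve w u a) x" for x
  proof -
    define k where "k = \<lfloor>x\<rfloor>"
    \<comment> \<open>Two adjacent segments are joined so that \<open>x\<close> is an inner point
      even when it is an integer.\<close>
    have "continuous_on ({real_of_int (k - 1)..real_of_int (k - 1) + 1} \<union> {real_of_int k..real_of_int k + 1})
        (orbit_curve w u a)"
      by (intro continuous_on_closed_Un seg closed_atLeastAtMost)
    then have "continuous_on {real_of_int k - 1<..<real_of_int k + 1} (orbit_curve w u a)"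
      by (rule continuous_on_subset) auto
    moreover have "x \<in> {real_of_int k - 1<..<real_of_int k + 1}"
      unfolding k_def greaterThanLessThan_iff by linarith
    ultimately show ?thesis
      by (simp add: continuous_on_eq_continuous_at)
  qed
  then show ?thesis by (simp add: continuous_at_imp_continuous_on)
qed

lemma range_orbit_curve: "range (orbit_curve w u a) = (\<Union>k. node_arc w u (orb w u a k))"
proof (intro equalityI subsetI)
  fix z assume "z \<in> range (orbit_curve w u a)"
  then obtain x where "z = arc_pt w u (orb w u a \<lfloor>x\<rfloor>) (frac x)" by (auto simp: orbit_curve_def)
  moreover have "frac x \<in> {0..1}" using frac_ge_0[of x] frac_lt_1[of x] by simp
  ultimately show "z \<in> (\<Union>k. node_arc w u (orb w u a k))" unfolding node_arc_def by blast
next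
  fix z assume "z \<in> (\<Union>k. node_arc w u (orb w u a k))"
  then obtain k s where "s \<in> {0..1}" "z = arc_pt w u (orb w u a k) s" by (auto simp: node_arc_def)
  then have "z = orbit_curve w u a (of_int k + s)"
    by (subst orbit_curve_on_segment[of _ k]) auto
  then show "z \<in> range (orbit_curve w u a)" by blast
qed

text \<open>Handing the endpoint of an arc to its successor brings every point into the half-open
  form that \<open>arc_pt_inject\<close> requires.\<close>

lemma node_arc_half_open:
  assumes "z \<in> node_arc w u a"
  obtains s b where "s \<in> {0..<1}" "z = arc_pt w u b s" "b = a \<or> b = next_arc w u a"
proof -
  obtain s where s: "s \<in> {0..1}" "z = arc_pt w u a s" using assms by (auto simp: node_arc_def)
  show thesis
  proof (cases "s = 1")
    case True
    then show ?thesis using that[of 0 "next_arc w u a"] s by (simp add: arc_pt_next_arc)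
  next
    case False
    then show ?thesis using that[of s a] s by simp
  qed
qed

text \<open>An arc stays within 1/2 of the centre of its tile in each coordinate. This local
  finiteness serves twice: unions of arcs are closed, and an infinite orbit leaves every
  ball.\<close>

lemma finite_node_arcs_meeting_bounded:
  assumes "w \<in> Omega_pm" "u \<in> Omega_pm" "bounded B"
  shows "finite {a. node_arc w u a \<inter> B \<noteq> {}}"
proof -
  obtain R where R: "\<And>z. z \<in> B \<Longrightarrow> norm z \<le> R" using assms(3) bounded_iff by blast
  define N where "N = \<lceil>R\<rceil> + 1"
  have "{a. node_arc w u a \<inter> B \<noteq> {}} \<subseteq> {-N..N} \<times> {-N..N} \<times> UNIV"
  proof
    fix a assume "a \<in> {a. node_arc w u a \<inter> B \<noteq> {}}"
    moreover obtain m n b where a: "a = (m, n, b)" by (cases a) auto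
    ultimately obtain s where s: "s \<in> {0..1}" "arc_pt w u (m, n, b) s \<in> B"
      unfolding node_arc_def by blast
    define z where "z = arc_pt w u (m, n, b) s"
    have "\<bar>fst z\<bar> \<le> R" "\<bar>snd z\<bar> \<le> R"
      using R[OF s(2)] norm_fst_le[of "fst z" "snd z"] norm_snd_le[of "snd z" "fst z"]
      by (simp_all add: z_def)
    moreover have "\<bar>fst z - m\<bar> \<le> 1/2" "\<bar>snd z - n\<bar> \<le> 1/2"
      using arc_pt_near[OF assms(1,2) s(1), of m n b] unfolding z_def by blast+
    ultimately have "\<bar>m\<bar> \<le> N" "\<bar>n\<bar> \<le> N"
      unfolding N_def by linarith+
    then show "a \<in> {-N..N} \<times> {-N..N} \<times> UNIV" by (simp add: a abs_le_iff)
  qed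
  then show ?thesis by (rule finite_subset) simp
qed

text \<open>The arcs are compact and form a locally finite family. The index set is arbitrary
  because both an orbit and its complement are needed.\<close>

lemma closed_Union_node_arcs:
  assumes "w \<in> Omega_pm" "u \<in> Omega_pm"
  shows "closed (\<Union>a\<in>K. node_arc w u a)"
proof -
  have "closedin euclidean (\<Union> (node_arc w u ` K))"
  proof (rule closedin_locally_finite_Union)
    fix A assume "A \<in> node_arc w u ` K"
    then show "closedin euclidean A"
      by (auto simp: node_arc_def intro!: compact_imp_closed compact_continuous_image continuous_on_arc_pt)
  next
    have "finite {A \<in> node_arc w u ` K. A \<inter> ball x 1 \<noteq> {}}" for x
    proof (rule finite_subset)
      show "finite (node_arc w u ` {a. node_arc w u a \<inter> ball x 1 \<noteq> {}})"
        by (intro finite_imageI finite_node_arcs_meeting_bounded assms bounded_ball)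
    qed blast
    then have "\<exists>V. openin euclidean V \<and> x \<in> V \<and> finite {A \<in> node_arc w u ` K. A \<inter> V \<noteq> {}}" for x
      by (intro exI[of _ "ball x 1"]) simp
    then show "locally_finite_in euclidean (node_arc w u ` K)"
      unfolding locally_finite_in_def by simp
  qed
  then show ?thesis by simp
qed

text \<open>The curve is connected and closed, and the arcs off the orbit form a closed set disjoint
  from it. A connected subset of the union that meets the curve therefore cannot leave it.\<close>

lemma connected_component_node_arcs:
  assumes "w \<in> Omega_pm" "u \<in> Omega_pm"
  shows "connected_component_set (\<Union>a. node_arc w u a) (arc_pt w u a 0) = range (orbit_curve w u a)"
    (is "?C = ?P")
proof
  have z: "arc_pt w u a 0 = orbit_curve w u a 0" by (simp add: orbit_curve_def)
  show "?P \<subseteq> ?C"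
    unfolding z
    by (intro connected_component_maximal connected_continuous_image continuous_on_orbit_curve)
       (use range_orbit_curve[of w u a] in auto)
  define K where "K = range (orb w u a)"
  define R where "R = (\<Union>b\<in>-K. node_arc w u b)"
  have P: "?P = (\<Union>b\<in>K. node_arc w u b)" by (simp add: range_orbit_curve K_def)
  have disj: "?P \<inter> R = {}"
  proof (rule ccontr)
    assume "?P \<inter> R \<noteq> {}"
    \<comment> \<open>The half-open representation of a common point is unique, so its arc would lie
      both on and off the orbit, as membership in the orbit is unchanged by
      \<open>next_arc\<close>.\<close>
    then obtain y b c where y: "y \<in> node_arc w u b" "y \<in> node_arc w u c" "b \<in> K" "c \<notin> K"
      unfolding P R_def by blast
    obtain s b' where b': "s \<in> {0..<1}" "y = arc_pt w u b' s" "b' = b \<or> b' = next_arc w u b"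
      using node_arc_half_open[OF y(1)] by blast
    obtain t c' where c': "t \<in> {0..<1}" "y = arc_pt w u c' t" "c' = c \<or> c' = next_arc w u c"
      using node_arc_half_open[OF y(2)] by blast
    have "b' = c'" using arc_pt_inject[OF assms b'(1) c'(1)] b'(2) c'(2) by simp
    moreover have "b' \<in> K" using b'(3) y(3) next_arc_in_range_orb_iff[of w u b a] unfolding K_def by metis
    moreover have "c' \<notin> K" using c'(3) y(4) next_arc_in_range_orb_iff[of w u c a] unfolding K_def by metis
    ultimately show False by simp
  qed
  have "connected ?C" "?C \<subseteq> ?P \<union> R" "closed ?P" "closed R"
    using connected_component_subset[of "\<Union>a. node_arc w u a" "arc_pt w u a 0"]
    unfolding P R_def by (auto intro: closed_Union_node_arcs[OF assms])
  moreover have "?P \<inter> ?C \<noteq> {}" using \<open>?P \<subseteq> ?C\<close> by blast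
  ultimately have "R \<inter> ?C = {}"
    using disj unfolding connected_closed by blast
  then show "?C \<subseteq> ?P" using \<open>?C \<subseteq> ?P \<union> R\<close> by blast
qed

text \<open>A periodic orbit traces finitely many compact arcs, so its curve is bounded, whatever
  the parametrisation. A non-periodic orbit visits each arc at most once, so by local finiteness
  only finitely many of its indices belong to arcs meeting a given ball.\<close>

lemma bi_infinite_curve_iff_not_periodic:
  assumes "w \<in> Omega_pm" "u \<in> Omega_pm"
  shows "bi_infinite_curve (range (orbit_curve w u a)) \<longleftrightarrow> \<not> periodic w u a"
proof
  assume "bi_infinite_curve (range (orbit_curve w u a))"
  then obtain \<gamma> :: "real \<Rightarrow> real \<times> real" where
    \<gamma>: "range \<gamma> = range (orbit_curve w u a)" "filterlim \<gamma> at_infinity at_top"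
    unfolding bi_infinite_curve_def by blast
  show "\<not> periodic w u a"
  proof
    assume "periodic w u a"
    then have "bounded (\<Union>b\<in>range (orb w u a). node_arc w u b)"
      unfolding node_arc_def
      by (intro bounded_UN finite_range_orb ballI compact_imp_bounded compact_continuous_image
          continuous_on_arc_pt compact_Icc)
    then have "bounded (range \<gamma>)" by (simp add: \<gamma>(1) range_orbit_curve)
    then obtain R where R: "R > 0" "\<And>x. norm (\<gamma> x) \<le> R" by (auto simp: bounded_pos)
    have "eventually (\<lambda>x. R + 1 \<le> norm (\<gamma> x)) at_top"
      using \<gamma>(2) R(1) unfolding filterlim_at_infinity[OF order_refl] by simp
    then obtain x where "R + 1 \<le> norm (\<gamma> x)" by (metis eventually_at_top_linorder order_refl)
    with R(2)[of x] show False by simp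
  qed
next
  assume "\<not> periodic w u a"
  then have inj: "inj (orb w u a)" by (rule inj_orb)
  have far: "\<exists>N. \<forall>x. \<bar>x\<bar> \<ge> N \<longrightarrow> r \<le> norm (orbit_curve w u a x)" for r
  proof -
    have "finite (orb w u a -` {b. node_arc w u b \<inter> ball 0 r \<noteq> {}})"
      by (intro finite_vimageI finite_node_arcs_meeting_bounded assms bounded_ball inj)
    then obtain N where "abs ` (orb w u a -` {b. node_arc w u b \<inter> ball 0 r \<noteq> {}}) \<subseteq> {..<N}"
      unfolding finite_int_iff_bounded by blast
    then have N: "\<bar>k\<bar> < N" if "node_arc w u (orb w u a k) \<inter> ball 0 r \<noteq> {}" for k
      using that by (simp add: image_subset_iff)
    have "r \<le> norm (orbit_curve w u a x)" if "\<bar>x\<bar> \<ge> of_int N + 1" for x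
    proof (rule ccontr)
      assume "\<not> ?thesis"
      moreover have "orbit_curve w u a x \<in> node_arc w u (orb w u a \<lfloor>x\<rfloor>)"
        unfolding orbit_curve_def node_arc_def
        by (intro imageI) (simp add: frac_lt_1 less_imp_le)
      ultimately have "\<bar>\<lfloor>x\<rfloor>\<bar> < N" by (intro N) (metis IntI empty_iff mem_ball_0 not_le)
      with that show False by linarith
    qed
    then show ?thesis by blast
  qed
  have "filterlim (orbit_curve w u a) at_infinity at_top"
    unfolding filterlim_at_infinity[OF order_refl] eventually_at_top_linorder
    using far by (meson abs_ge_self order_trans)
  moreover have "filterlim (orbit_curve w u a) at_infinity at_bot"
    unfolding filterlim_at_infinity[OF order_refl] eventually_at_bot_linorder
  proof (intro allI impI)
    fix r :: real
    obtain N where N: "\<forall>x. \<bar>x\<bar> \<ge> N \<longrightarrow> r \<le> norm (orbit_curve w u a x)" using far by blast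
    show "\<exists>N. \<forall>x\<le>N. r \<le> norm (orbit_curve w u a x)"
      using N by (intro exI[of _ "- N"]) auto
  qed
  moreover have "inj (orbit_curve w u a)"
  proof (rule injI)
    fix x y assume "orbit_curve w u a x = orbit_curve w u a y"
    then have "orb w u a \<lfloor>x\<rfloor> = orb w u a \<lfloor>y\<rfloor> \<and> frac x = frac y"
      unfolding orbit_curve_def by (intro arc_pt_inject[OF assms]) (simp_all add: frac_lt_1)
    then have "\<lfloor>x\<rfloor> = \<lfloor>y\<rfloor>" "frac x = frac y" using injD[OF inj] by auto
    then show "x = y" by (simp add: frac_def)
  qed
  ultimately show "bi_infinite_curve (range (orbit_curve w u a))"
    unfolding bi_infinite_curve_def using continuous_on_orbit_curve by blast
qed

lemma bi_infinite_curve_through_iff: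
  assumes "w \<in> Omega_pm" "u \<in> Omega_pm" "e \<in> tiling_edges" "edge_midpoint e = arc_pt w u a 0"
  shows "bi_infinite_curve (curve_through (tau w u) e) \<longleftrightarrow> \<not> periodic w u a"
  using assms
  by (simp add: curve_through_eq Union_truchet_arcs_tau connected_component_node_arcs
      bi_infinite_curve_iff_not_periodic)

section \<open>Measure-preserving dynamics\<close>

definition shift_by :: "int \<Rightarrow> (int \<Rightarrow> int) \<Rightarrow> int \<Rightarrow> int" where
  "shift_by j w = (\<lambda>n. w (n + j))"

lemma shift_by_0 [simp]: "shift_by 0 = id"
  by (auto simp: shift_by_def)

lemma shift_by_apply: "shift_by j w n = w (n + j)"
  by (simp add: shift_by_def)

lemma shift_by_measurable: "shift_by j \<in> measurable borel_pm borel_pm"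
proof -
  have c: "continuous_map pm_topology pm_topology (shift_by j)"
    unfolding pm_topology_def shift_by_def continuous_map_componentwise_UNIV
    by (intro allI continuous_map_product_projection) simp
  show ?thesis
  proof (rule measurable_sigma_sets[OF sets_borel_pm])
    show "{U. openin pm_topology U} \<subseteq> Pow Omega_pm"
      using openin_subset topspace_pm_topology by blast
    show "shift_by j \<in> space borel_pm \<rightarrow> Omega_pm"
      by (auto simp: space_borel_pm Omega_pm_def shift_by_def)
    fix U assume "U \<in> {U. openin pm_topology U}"
    then have "openin pm_topology {\<omega> \<in> topspace pm_topology. shift_by j \<omega> \<in> U}"
      by (intro openin_continuous_map_preimage[OF c]) simp
    moreover have "shift_by j -` U \<inter> space borel_pm
                     = {\<omega> \<in> topspace pm_topology. shift_by j \<omega> \<in> U}"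
      by (auto simp: space_borel_pm topspace_pm_topology)
    ultimately show "shift_by j -` U \<inter> space borel_pm \<in> sets borel_pm"
      by (auto simp: sets_borel_pm)
  qed
qed

text \<open>Invariance makes the laws of \<open>shift_by (i + 1)\<close> and
  \<open>shift_by i\<close> equal for every integer \<open>i\<close>, so the induction runs in both
  directions from the identity.\<close>

lemma distr_shift_by:
  assumes sets: "sets \<mu> = sets borel_pm" and inv: "shift_invariant \<mu>"
  shows "distr \<mu> \<mu> (shift_by j) = \<mu>"
proof -
  have meas: "shift_by i \<in> measurable \<mu> \<mu>" "shift \<in> measurable \<mu> \<mu>" for i
    using shift_by_measurable shift_measurable measurable_cong_sets[OF sets sets] by auto
  have step: "distr \<mu> \<mu> (shift_by (i + 1)) = distr \<mu> \<mu> (shift_by i)" for i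
  proof -
    have "distr \<mu> \<mu> (shift_by i) = distr (distr \<mu> \<mu> shift) \<mu> (shift_by i)"
      using inv by (simp add: shift_invariant_def)
    also have "\<dots> = distr \<mu> \<mu> (shift_by i \<circ> shift)"
      using meas by (intro distr_distr)
    also have "shift_by i \<circ> shift = shift_by (i + 1)"
      by (auto simp: shift_by_def shift_def add.assoc)
    finally show ?thesis ..
  qed
  show ?thesis
  proof (induction j rule: int_induct[where k = 0])
    case base
    show ?case by (simp add: id_def)
  next
    case (step1 i)
    then show ?case using step by simp
  next
    case (step2 i)
    then show ?case using step[of "i - 1"] by simp
  qed
qed

text \<open>By Fubini it suffices to look at fibres: over \<open>x\<close> the map is the single
  measure-preserving map \<open>S (k x)\<close>. Countably many indices make the map jointly
  measurable.\<close>

lemma distr_skew_product_right: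
  fixes S :: "'i::countable \<Rightarrow> 'b \<Rightarrow> 'b"
  assumes "sigma_finite_measure N"
    and S: "\<And>i. S i \<in> measurable N N" "\<And>i. distr N N (S i) = N"
    and k: "k \<in> measurable M (count_space UNIV)"
  shows "(\<lambda>(x, y). (x, S (k x) y)) \<in> measurable (M \<Otimes>\<^sub>M N) (M \<Otimes>\<^sub>M N)"
    and "distr (M \<Otimes>\<^sub>M N) (M \<Otimes>\<^sub>M N) (\<lambda>(x, y). (x, S (k x) y)) = M \<Otimes>\<^sub>M N"
proof -
  interpret N: sigma_finite_measure N by fact
  have "(\<lambda>z. (fst z, S (k (fst z)) (snd z))) \<in> measurable (M \<Otimes>\<^sub>M N) (M \<Otimes>\<^sub>M N)"
    by (intro measurable_Pair measurable_fst
        measurable_compose_countable[where f = "\<lambda>i z. S i (snd z)" and g = "\<lambda>z. k (fst z)"]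
        measurable_compose[OF measurable_snd S(1)] measurable_compose[OF measurable_fst k])
  then show m: "(\<lambda>(x, y). (x, S (k x) y)) \<in> measurable (M \<Otimes>\<^sub>M N) (M \<Otimes>\<^sub>M N)"
    by (simp add: case_prod_beta')
  show "distr (M \<Otimes>\<^sub>M N) (M \<Otimes>\<^sub>M N) (\<lambda>(x, y). (x, S (k x) y)) = M \<Otimes>\<^sub>M N"
  proof (rule measure_eqI)
    fix A assume "A \<in> sets (distr (M \<Otimes>\<^sub>M N) (M \<Otimes>\<^sub>M N) (\<lambda>(x, y). (x, S (k x) y)))"
    then have A: "A \<in> sets (M \<Otimes>\<^sub>M N)" by simp
    let ?B = "(\<lambda>(x, y). (x, S (k x) y)) -` A \<inter> space (M \<Otimes>\<^sub>M N)"
    have "emeasure N (Pair x -` ?B) = emeasure N (Pair x -` A)" if "x \<in> space M" for x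
    proof -
      have "emeasure N (Pair x -` A) = emeasure (distr N N (S (k x))) (Pair x -` A)"
        by (simp add: S(2))
      also have "\<dots> = emeasure N (S (k x) -` (Pair x -` A) \<inter> space N)"
        by (rule emeasure_distr[OF S(1) sets_Pair1[OF A]])
      also have "S (k x) -` (Pair x -` A) \<inter> space N = Pair x -` ?B"
        using that by (auto simp: space_pair_measure)
      finally show ?thesis ..
    qed
    then show "emeasure (distr (M \<Otimes>\<^sub>M N) (M \<Otimes>\<^sub>M N) (\<lambda>(x, y). (x, S (k x) y))) A = emeasure (M \<Otimes>\<^sub>M N) A"
      using measurable_sets[OF m A] A
      by (simp add: emeasure_distr[OF m] N.emeasure_pair_measure_alt cong: nn_integral_cong)
  qed simp
qed

text \<open>Exchanging the factors conjugates this map to a skew product of the previous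
  kind.\<close>

lemma distr_skew_product_left:
  fixes S :: "'i::countable \<Rightarrow> 'a \<Rightarrow> 'a"
  assumes sf: "sigma_finite_measure M" "sigma_finite_measure N"
    and S: "\<And>i. S i \<in> measurable M M" "\<And>i. distr M M (S i) = M"
    and k: "k \<in> measurable N (count_space UNIV)"
  shows "(\<lambda>(x, y). (S (k y) x, y)) \<in> measurable (M \<Otimes>\<^sub>M N) (M \<Otimes>\<^sub>M N)"
    and "distr (M \<Otimes>\<^sub>M N) (M \<Otimes>\<^sub>M N) (\<lambda>(x, y). (S (k y) x, y)) = M \<Otimes>\<^sub>M N"
proof -
  interpret pair_sigma_finite M N using sf by (simp add: pair_sigma_finite_def)
  let ?swap = "\<lambda>(x, y). (y, x)" and ?T = "\<lambda>(y, x). (y, S (k y) x)"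
  have T: "?T \<in> measurable (N \<Otimes>\<^sub>M M) (N \<Otimes>\<^sub>M M)" "distr (N \<Otimes>\<^sub>M M) (N \<Otimes>\<^sub>M M) ?T = N \<Otimes>\<^sub>M M"
    using distr_skew_product_right[OF sf(1) S k] by auto
  have comp: "(\<lambda>(x, y). (S (k y) x, y)) = ?swap \<circ> ?T \<circ> ?swap" by auto
  show "(\<lambda>(x, y). (S (k y) x, y)) \<in> measurable (M \<Otimes>\<^sub>M N) (M \<Otimes>\<^sub>M N)"
    unfolding comp by (intro measurable_comp[OF measurable_pair_swap'] measurable_comp[OF T(1)] measurable_pair_swap')
  have swap: "distr (N \<Otimes>\<^sub>M M) (M \<Otimes>\<^sub>M N) ?swap = M \<Otimes>\<^sub>M N" "distr (M \<Otimes>\<^sub>M N) (N \<Otimes>\<^sub>M M) ?swap = N \<Otimes>\<^sub>M M"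
    using distr_pair_swap pair_sigma_finite.distr_pair_swap[of N M] sf
    by (auto simp: pair_sigma_finite_def)
  have "distr (M \<Otimes>\<^sub>M N) (M \<Otimes>\<^sub>M N) (?swap \<circ> ?T \<circ> ?swap) =
      distr (distr (distr (M \<Otimes>\<^sub>M N) (N \<Otimes>\<^sub>M M) ?swap) (N \<Otimes>\<^sub>M M) ?T) (M \<Otimes>\<^sub>M N) ?swap"
    by (simp add: distr_distr T(1) measurable_pair_swap' comp_assoc measurable_comp[OF measurable_pair_swap' T(1)])
  then show "distr (M \<Otimes>\<^sub>M N) (M \<Otimes>\<^sub>M N) (\<lambda>(x, y). (S (k y) x, y)) = M \<Otimes>\<^sub>M N"
    unfolding comp by (simp add: swap T(2))
qed

text \<open>Let \<open>g\<close> be \<open>f\<close> cut off to \<open>C\<close>. Its averages along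
  \<open>T\<close> all have the same expectation and tend to 0 pointwise, so \<open>g\<close> has
  mean 0. The rest of \<open>f\<close> is bounded by 1 and lives off \<open>C\<close>.\<close>

lemma (in prob_space) abs_expectation_le_if_bounded_sums:
  fixes f :: "'a \<Rightarrow> real"
  assumes T: "T \<in> measurable M M" "distr M M T = M"
    and f: "f \<in> borel_measurable M" "\<And>x. x \<in> space M \<Longrightarrow> \<bar>f x\<bar> \<le> 1"
    and C: "C \<in> events" "\<And>x. x \<in> space M \<Longrightarrow> T x \<in> C \<longleftrightarrow> x \<in> C"
    and bounded: "\<And>x. x \<in> C \<Longrightarrow> \<exists>B. \<forall>k. \<bar>\<Sum>i<k. f ((T ^^ i) x)\<bar> \<le> B"
  shows "\<bar>expectation f\<bar> \<le> prob (space M - C)"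
proof -
  define g where "g = (\<lambda>x. indicator C x * f x)"
  have g: "g \<in> borel_measurable M" "\<And>x. x \<in> space M \<Longrightarrow> \<bar>g x\<bar> \<le> 1"
    using f C(1) by (auto simp: g_def indicator_def)
  have Tn: "T ^^ i \<in> measurable M M" for i
    by (induction i) (auto simp: comp_def intro: measurable_compose[OF _ T(1)])
  have sp: "(T ^^ i) x \<in> space M" if "x \<in> space M" for i x
    using measurable_space[OF Tn that] .
  have gT: "integrable M (\<lambda>x. g ((T ^^ i) x))" for i
    using g(2) sp by (intro integrable_const_bound[where B = 1] measurable_compose[OF Tn g(1)]) auto
  have int_gT: "expectation (\<lambda>x. g ((T ^^ i) x)) = expectation g" for i
  proof (induction i)
    case (Suc i)
    have "expectation (\<lambda>x. g ((T ^^ Suc i) x)) = expectation (\<lambda>x. g ((T ^^ i) (T x)))"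
      by (simp add: funpow_swap1)
    also have "\<dots> = integral\<^sup>L (distr M M T) (\<lambda>x. g ((T ^^ i) x))"
      by (intro integral_distr[symmetric] T(1) measurable_compose[OF Tn g(1)])
    finally show ?case using Suc T(2) by simp
  qed simp
  \<comment> \<open>By invariance of \<open>C\<close>, the sums of \<open>g\<close> along an orbit
    are either those of \<open>f\<close> or identically 0.\<close>
  have inC: "(T ^^ i) x \<in> C \<longleftrightarrow> x \<in> C" if "x \<in> space M" for i x
    by (induction i) (simp_all add: C(2) sp that)
  \<comment> \<open>Averaging \<open>Suc k\<close> terms keeps the denominator positive.\<close>
  define h where "h = (\<lambda>k x. (\<Sum>i<Suc k. g ((T ^^ i) x)) / real (Suc k))"
  have "(\<lambda>k. expectation (h k)) \<longlonglongrightarrow> expectation (\<lambda>_. 0)"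
  proof (rule integral_dominated_convergence[where w = "\<lambda>_. 1"])
    show "h k \<in> borel_measurable M" for k
      unfolding h_def
      by (intro borel_measurable_divide borel_measurable_sum borel_measurable_const measurable_compose[OF Tn g(1)])
    show "AE x in M. norm (h k x) \<le> 1" for k
    proof (rule AE_I2)
      fix x assume x: "x \<in> space M"
      have "\<bar>\<Sum>i<Suc k. g ((T ^^ i) x)\<bar> \<le> (\<Sum>i<Suc k. 1)"
        by (intro order_trans[OF sum_abs sum_mono] g(2) sp[OF x])
      then show "norm (h k x) \<le> 1" by (simp add: h_def)
    qed
    show "AE x in M. (\<lambda>k. h k x) \<longlonglongrightarrow> 0"
    proof (rule AE_I2)
      fix x assume x: "x \<in> space M"
      have "\<exists>B. \<forall>k. \<bar>\<Sum>i<k. g ((T ^^ i) x)\<bar> \<le> B"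
        using bounded[of x] inC[OF x] by (cases "x \<in> C") (auto simp: g_def)
      then obtain B where B: "\<And>k. \<bar>\<Sum>i<k. g ((T ^^ i) x)\<bar> \<le> B" by blast
      show "(\<lambda>k. h k x) \<longlonglongrightarrow> 0"
      proof (rule Lim_null_comparison)
        show "\<forall>\<^sub>F k in sequentially. norm (h k x) \<le> B * inverse (real (Suc k))"
          using B by (simp add: h_def divide_inverse abs_mult mult_right_mono del: of_nat_Suc sum.lessThan_Suc)
        show "(\<lambda>k. B * inverse (real (Suc k))) \<longlonglongrightarrow> 0"
          using tendsto_mult_right_zero[OF LIMSEQ_inverse_real_of_nat] .
      qed
    qed
  qed auto
  moreover have "expectation (h k) = expectation g" for k
    unfolding h_def using gT by (simp add: int_gT del: of_nat_Suc sum.lessThan_Suc)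
  ultimately have g0: "expectation g = 0" by (simp add: LIMSEQ_const_iff)
  have intf: "integrable M f" using f by (intro integrable_const_bound[where B = 1]) auto
  \<comment> \<open>Subtracting \<open>g\<close> leaves the mean unchanged and removes
    \<open>f\<close> on \<open>C\<close>.\<close>
  have "expectation f = expectation (\<lambda>x. f x - g x)"
    using gT[of 0] intf g0 by simp
  also have "\<bar>\<dots>\<bar> \<le> expectation (\<lambda>x. \<bar>f x - g x\<bar>)"
    by (rule integral_abs_bound)
  also have "\<dots> \<le> expectation (indicator (space M - C))"
    using gT[of 0] intf C(1) f(2)
    by (intro integral_mono) (auto simp: g_def indicator_def emeasure_eq_measure)
  also have "\<dots> = prob (space M - C)" using C(1) by simp
  finally show ?thesis .
qed

section \<open>Recentring along a curve\<close>

lemma next_arc_shift_by: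
  "map_prod ((+) i) (map_prod ((+) j) (\<lambda>b. b)) (next_arc (shift_by i w) (shift_by j u) a) =
    next_arc w u (map_prod ((+) i) (map_prod ((+) j) (\<lambda>b. b)) a)"
  by (cases "(w, u, a)" rule: next_arc.cases) (auto simp: shift_by_def add_ac)

text \<open>The translation of arcs is injective and intertwines the two dynamics, so it preserves
  return times.\<close>

lemma periodic_shift_by:
  "periodic (shift_by i w) (shift_by j u) (m, n, b) \<longleftrightarrow> periodic w u (i + m, j + n, b)"
proof -
  let ?t = "map_prod ((+) i) (map_prod ((+) j) (\<lambda>b. b)) :: int \<times> int \<times> bool \<Rightarrow> _"
  have pow: "?t ((next_arc (shift_by i w) (shift_by j u) ^^ k) a) = (next_arc w u ^^ k) (?t a)" for k a
    by (induction k) (simp_all add: next_arc_shift_by)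
  have "inj ?t" by (auto simp: inj_on_def)
  then have "(next_arc (shift_by i w) (shift_by j u) ^^ k) a = a \<longleftrightarrow> (next_arc w u ^^ k) (?t a) = ?t a" for k a
    by (metis injD pow)
  from this[of _ "(m, n, b)"] show ?thesis by (simp add: periodic_def)
qed

text \<open>The vertical step from the origin leads to the tile \<open>(0, w 0)\<close>, and
  recentring there shifts \<open>u\<close> only. The amount depends on the component left in place,
  so this is a skew product; \<open>row_step\<close> is the horizontal counterpart.\<close>

definition column_step :: "(int \<Rightarrow> int) \<times> (int \<Rightarrow> int) \<Rightarrow> (int \<Rightarrow> int) \<times> (int \<Rightarrow> int)" where
  "column_step = (\<lambda>(w, u). (w, shift_by (w 0) u))"

definition row_step :: "(int \<Rightarrow> int) \<times> (int \<Rightarrow> int) \<Rightarrow> (int \<Rightarrow> int) \<times> (int \<Rightarrow> int)" where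
  "row_step = (\<lambda>(w, u). (shift_by (u 0) w, u))"

text \<open>Two arcs of the curve starting at the tile at the origin, after which the picture is
  translated so that the tile reached is again at the origin.\<close>

definition double_step :: "(int \<Rightarrow> int) \<times> (int \<Rightarrow> int) \<Rightarrow> (int \<Rightarrow> int) \<times> (int \<Rightarrow> int)" where
  "double_step = row_step \<circ> column_step"

lemma double_step_eq: "double_step (w, u) = (shift_by (u (w 0)) w, shift_by (w 0) u)"
  by (simp add: double_step_def row_step_def column_step_def shift_by_apply)

definition closed_pairs :: "((int \<Rightarrow> int) \<times> (int \<Rightarrow> int)) set" where
  "closed_pairs = {(w, u). w \<in> Omega_pm \<and> u \<in> Omega_pm \<and> periodic w u (0, 0, True)}"

lemma shift_by_in_Omega_pm_iff: "shift_by j w \<in> Omega_pm \<longleftrightarrow> w \<in> Omega_pm"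
proof -
  have "(\<forall>n. w (n + j) \<in> {-1, 1}) \<longleftrightarrow> (\<forall>n. w n \<in> {-1, 1})" by (metis diff_add_cancel)
  then show ?thesis by (simp add: Omega_pm_def shift_by_def)
qed

text \<open>Two arcs further along, the curve is still the same, and recentring does not affect
  whether it closes up.\<close>

lemma double_step_in_closed_pairs_iff: "double_step x \<in> closed_pairs \<longleftrightarrow> x \<in> closed_pairs"
proof -
  obtain w u where x: "x = (w, u)" by (cases x)
  have "(u (w 0), w 0, True) = next_arc w u (next_arc w u (0, 0, True))" by simp
  then have "periodic w u (u (w 0), w 0, True) \<longleftrightarrow> periodic w u (0, 0, True)"
    by (simp only: periodic_next_arc_iff)
  then show ?thesis
    by (simp add: x double_step_eq closed_pairs_def shift_by_in_Omega_pm_iff periodic_shift_by)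
qed

text \<open>The sums \<open>X k\<close> and \<open>Y k\<close> of recentred steps are the position
  on one fixed curve after \<open>2 * k\<close> arcs. In \<open>X\<close> the step is read after
  \<open>column_step\<close>, because a horizontal step is taken in the row reached by the preceding
  vertical one.\<close>

lemma double_step_funpow:
  fixes w u
  defines "X \<equiv> \<lambda>k. \<Sum>i<k. snd (column_step ((double_step ^^ i) (w, u))) 0"
    and "Y \<equiv> \<lambda>k. \<Sum>i<k. fst ((double_step ^^ i) (w, u)) 0"
  shows "(double_step ^^ k) (w, u) = (shift_by (X k) w, shift_by (Y k) u)"
    and "(next_arc w u ^^ (2 * k)) (0, 0, True) = (X k, Y k, True)"
proof -
  have "(double_step ^^ k) (w, u) = (shift_by (X k) w, shift_by (Y k) u) \<and>
    (next_arc w u ^^ (2 * k)) (0, 0, True) = (X k, Y k, True)"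
  proof (induction k)
    case 0
    show ?case by (simp add: X_def Y_def)
  next
    case (Suc k)
    have Y: "Y (Suc k) = Y k + w (X k)"
      using Suc by (simp add: Y_def shift_by_apply)
    have X: "X (Suc k) = X k + u (Y k + w (X k))"
      using Suc by (simp add: X_def column_step_def shift_by_apply add_ac)
    show ?case
      using Suc unfolding X Y
      by (simp add: double_step_eq shift_by_def add_ac)
  qed
  then show "(double_step ^^ k) (w, u) = (shift_by (X k) w, shift_by (Y k) u)"
    "(next_arc w u ^^ (2 * k)) (0, 0, True) = (X k, Y k, True)" by blast+
qed

text \<open>The sums are coordinates of arcs on a finite orbit, so they take finitely many
  values.\<close>

lemma bounded_displacement:
  assumes "(w, u) \<in> closed_pairs"
  shows "\<exists>B. \<forall>k. \<bar>\<Sum>i<k. real_of_int (fst ((double_step ^^ i) (w, u)) 0)\<bar> \<le> B"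
    and "\<exists>B. \<forall>k. \<bar>\<Sum>i<k. real_of_int (snd (column_step ((double_step ^^ i) (w, u))) 0)\<bar> \<le> B"
proof -
  have fin: "finite (range (orb w u (0, 0, True)))"
    using assms by (intro finite_range_orb) (simp add: closed_pairs_def)
  have bd: "\<exists>B. \<forall>k. \<bar>real_of_int (f ((next_arc w u ^^ (2 * k)) (0, 0, True)))\<bar> \<le> B" for f
  proof -
    have "(next_arc w u ^^ (2 * k)) (0, 0, True) \<in> range (orb w u (0, 0, True))" for k
      using orb_add_nat[of w u "(0, 0, True)" 0 "2 * k"] by (metis orb_0 rangeI)
    then have "(\<lambda>k. \<bar>real_of_int (f ((next_arc w u ^^ (2 * k)) (0, 0, True)))\<bar>) ` UNIV \<subseteq>
      (\<lambda>a. \<bar>real_of_int (f a)\<bar>) ` range (orb w u (0, 0, True))" by blast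
    then have "finite (range (\<lambda>k. \<bar>real_of_int (f ((next_arc w u ^^ (2 * k)) (0, 0, True)))\<bar>))"
      by (rule finite_subset) (intro finite_imageI fin)
    then show ?thesis by (meson Max_ge rangeI)
  qed
  show "\<exists>B. \<forall>k. \<bar>\<Sum>i<k. real_of_int (fst ((double_step ^^ i) (w, u)) 0)\<bar> \<le> B"
    using bd[of "\<lambda>(m, n, b). n"] by (simp add: double_step_funpow(2))
  show "\<exists>B. \<forall>k. \<bar>\<Sum>i<k. real_of_int (snd (column_step ((double_step ^^ i) (w, u))) 0)\<bar> \<le> B"
    using bd[of "\<lambda>(m, n, b). m"] by (simp add: double_step_funpow(2))
qed

section \<open>Measurability of the set of closed curves\<close>

lemma coordinate_measurable_UNIV: "(\<lambda>w. w n) \<in> measurable borel_pm (count_space UNIV)"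
  by (rule measurable_compose[OF coordinate_measurable]) simp

text \<open>There are countably many arcs, so it suffices to treat one step from a fixed arc, and
  such a step reads a single coordinate of one sequence.\<close>

lemma next_arc_funpow_measurable:
  "(\<lambda>x. (next_arc (fst x) (snd x) ^^ k) a) \<in> measurable (borel_pm \<Otimes>\<^sub>M borel_pm) (count_space UNIV)"
proof (induction k)
  case (Suc k)
  have "(\<lambda>x. next_arc (fst x) (snd x) b) \<in> measurable (borel_pm \<Otimes>\<^sub>M borel_pm) (count_space UNIV)" for b
  proof -
    obtain m n c where b: "b = (m, n, c)" by (cases b) auto
    have "(\<lambda>x. (m, n + fst x m, False)) \<in> measurable (borel_pm \<Otimes>\<^sub>M borel_pm) (count_space UNIV)"
      by (rule measurable_compose[OF measurable_compose[OF measurable_fst coordinate_measurable_UNIV[of m]],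
            where g = "\<lambda>v. (m, n + v, False)"]) simp
    moreover have "(\<lambda>x. (m + snd x n, n, True)) \<in> measurable (borel_pm \<Otimes>\<^sub>M borel_pm) (count_space UNIV)"
      by (rule measurable_compose[OF measurable_compose[OF measurable_snd coordinate_measurable_UNIV[of n]],
            where g = "\<lambda>v. (m + v, n, True)"]) simp
    ultimately show ?thesis by (cases c) (simp_all add: b)
  qed
  then show ?case
    using measurable_compose_countable[OF _ Suc, of "\<lambda>b x. next_arc (fst x) (snd x) b"] by simp
qed simp

lemma closed_pairs_measurable: "closed_pairs \<in> sets (borel_pm \<Otimes>\<^sub>M borel_pm)"
proof -
  have "{x \<in> space (borel_pm \<Otimes>\<^sub>M borel_pm). (next_arc (fst x) (snd x) ^^ k) a = a}
      \<in> sets (borel_pm \<Otimes>\<^sub>M borel_pm)" for k a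
    using measurable_sets[OF next_arc_funpow_measurable[of k a], of "{a}"]
    by (simp add: vimage_def Int_def conj_commute)
  then have "(\<Union>k\<in>{0<..}. {x \<in> space (borel_pm \<Otimes>\<^sub>M borel_pm).
      (next_arc (fst x) (snd x) ^^ k) (0, 0, True) = (0, 0, True)}) \<in> sets (borel_pm \<Otimes>\<^sub>M borel_pm)"
    by (intro sets.countable_UN'') auto
  also have "(\<Union>k\<in>{0<..}. {x \<in> space (borel_pm \<Otimes>\<^sub>M borel_pm).
      (next_arc (fst x) (snd x) ^^ k) (0, 0, True) = (0, 0, True)}) = closed_pairs"
    by (auto simp: closed_pairs_def periodic_def space_pair_measure space_borel_pm)
  finally show ?thesis .
qed

section \<open>The product of two invariant measures\<close>

locale shift_invariant_pair =
  fixes \<mu> \<mu>' :: "(int \<Rightarrow> int) measure"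
  assumes borel: "borel_prob_pm \<mu>" "borel_prob_pm \<mu>'"
    and invariant: "shift_invariant \<mu>" "shift_invariant \<mu>'"
begin

sublocale left: prob_space \<mu>
  using borel(1) by (simp add: borel_prob_pm_def)

sublocale right: prob_space \<mu>'
  using borel(2) by (simp add: borel_prob_pm_def)

sublocale P: pair_prob_space \<mu> \<mu>' ..

lemma sets_factors: "sets \<mu> = sets borel_pm" "sets \<mu>' = sets borel_pm"
  using borel by (auto simp: borel_prob_pm_def)

lemma sets_pair: "sets (\<mu> \<Otimes>\<^sub>M \<mu>') = sets (borel_pm \<Otimes>\<^sub>M borel_pm)"
  by (intro sets_pair_measure_cong sets_factors)

lemma space_pair: "space (\<mu> \<Otimes>\<^sub>M \<mu>') = Omega_pm \<times> Omega_pm"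
  using sets_eq_imp_space_eq[OF sets_pair] by (simp add: space_pair_measure space_borel_pm)

lemma coordinate_measurable':
  "(\<lambda>w. f (w n)) \<in> measurable \<mu> (count_space UNIV)"
  "(\<lambda>w. f (w n)) \<in> measurable \<mu>' (count_space UNIV)"
proof -
  have "(\<lambda>w. f (w n)) \<in> measurable borel_pm (count_space UNIV)"
    by (rule measurable_compose[OF coordinate_measurable_UNIV]) simp
  then show "(\<lambda>w. f (w n)) \<in> measurable \<mu> (count_space UNIV)"
    "(\<lambda>w. f (w n)) \<in> measurable \<mu>' (count_space UNIV)"
    by (simp_all only: measurable_cong_sets[OF sets_factors(1) refl] measurable_cong_sets[OF sets_factors(2) refl])
qed

lemma shift_by_measurable':
  "shift_by j \<in> measurable \<mu> \<mu>" "shift_by j \<in> measurable \<mu>' \<mu>'"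
  by (simp_all only: measurable_cong_sets[OF sets_factors(1) sets_factors(1)]
      measurable_cong_sets[OF sets_factors(2) sets_factors(2)] shift_by_measurable)

lemma skew_right:
  assumes "k \<in> measurable \<mu> (count_space UNIV)"
  shows "(\<lambda>(w, u). (w, shift_by (k w) u)) \<in> measurable (\<mu> \<Otimes>\<^sub>M \<mu>') (\<mu> \<Otimes>\<^sub>M \<mu>')"
    and "distr (\<mu> \<Otimes>\<^sub>M \<mu>') (\<mu> \<Otimes>\<^sub>M \<mu>') (\<lambda>(w, u). (w, shift_by (k w) u)) = \<mu> \<Otimes>\<^sub>M \<mu>'"
  using distr_skew_product_right[where S = shift_by, OF right.sigma_finite_measure_axioms shift_by_measurable'(2)
      distr_shift_by[OF sets_factors(2) invariant(2)] assms] by blast+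

lemma skew_left:
  assumes "k \<in> measurable \<mu>' (count_space UNIV)"
  shows "(\<lambda>(w, u). (shift_by (k u) w, u)) \<in> measurable (\<mu> \<Otimes>\<^sub>M \<mu>') (\<mu> \<Otimes>\<^sub>M \<mu>')"
    and "distr (\<mu> \<Otimes>\<^sub>M \<mu>') (\<mu> \<Otimes>\<^sub>M \<mu>') (\<lambda>(w, u). (shift_by (k u) w, u)) = \<mu> \<Otimes>\<^sub>M \<mu>'"
  using distr_skew_product_left[where S = shift_by, OF left.sigma_finite_measure_axioms right.sigma_finite_measure_axioms
      shift_by_measurable'(1) distr_shift_by[OF sets_factors(1) invariant(1)] assms] by blast+

lemma column_step_preserving:
  "column_step \<in> measurable (\<mu> \<Otimes>\<^sub>M \<mu>') (\<mu> \<Otimes>\<^sub>M \<mu>')"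
  "distr (\<mu> \<Otimes>\<^sub>M \<mu>') (\<mu> \<Otimes>\<^sub>M \<mu>') column_step = \<mu> \<Otimes>\<^sub>M \<mu>'"
  unfolding column_step_def by (rule skew_right[OF coordinate_measurable'(1)[of "\<lambda>v. v" 0]])+

lemma row_step_preserving:
  "row_step \<in> measurable (\<mu> \<Otimes>\<^sub>M \<mu>') (\<mu> \<Otimes>\<^sub>M \<mu>')"
  "distr (\<mu> \<Otimes>\<^sub>M \<mu>') (\<mu> \<Otimes>\<^sub>M \<mu>') row_step = \<mu> \<Otimes>\<^sub>M \<mu>'"
  unfolding row_step_def by (rule skew_left[OF coordinate_measurable'(2)[of "\<lambda>v. v" 0]])+

lemma double_step_preserving:
  "double_step \<in> measurable (\<mu> \<Otimes>\<^sub>M \<mu>') (\<mu> \<Otimes>\<^sub>M \<mu>')"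
  "distr (\<mu> \<Otimes>\<^sub>M \<mu>') (\<mu> \<Otimes>\<^sub>M \<mu>') double_step = \<mu> \<Otimes>\<^sub>M \<mu>'"
proof -
  show "double_step \<in> measurable (\<mu> \<Otimes>\<^sub>M \<mu>') (\<mu> \<Otimes>\<^sub>M \<mu>')"
    unfolding double_step_def by (rule measurable_comp[OF column_step_preserving(1) row_step_preserving(1)])
  show "distr (\<mu> \<Otimes>\<^sub>M \<mu>') (\<mu> \<Otimes>\<^sub>M \<mu>') double_step = \<mu> \<Otimes>\<^sub>M \<mu>'"
    using distr_distr[OF row_step_preserving(1) column_step_preserving(1)]
    by (simp add: double_step_def column_step_preserving(2) row_step_preserving(2))
qed

lemma distr_snd: "distr (\<mu> \<Otimes>\<^sub>M \<mu>') \<mu>' snd = \<mu>'"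
proof -
  have "distr (\<mu> \<Otimes>\<^sub>M \<mu>') \<mu>' snd = distr (\<mu> \<Otimes>\<^sub>M \<mu>') \<mu>' (fst \<circ> (\<lambda>(x, y). (y, x)))"
    by (simp add: comp_def case_prod_beta' prod.case_distrib)
  also have "\<dots> = distr (distr (\<mu> \<Otimes>\<^sub>M \<mu>') (\<mu>' \<Otimes>\<^sub>M \<mu>) (\<lambda>(x, y). (y, x))) \<mu>' fst"
    by (intro distr_distr[symmetric] measurable_fst measurable_pair_swap')
  also have "distr (\<mu> \<Otimes>\<^sub>M \<mu>') (\<mu>' \<Otimes>\<^sub>M \<mu>) (\<lambda>(x, y). (y, x)) = \<mu>' \<Otimes>\<^sub>M \<mu>"
    by (rule pair_sigma_finite.distr_pair_swap[symmetric])
       (simp add: pair_sigma_finite_def left.sigma_finite_measure_axioms right.sigma_finite_measure_axioms)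
  finally show ?thesis by (simp add: left.distr_pair_fst)
qed

lemma coordinate_borel_measurable:
  "(\<lambda>w. real_of_int (w n)) \<in> borel_measurable \<mu>" "(\<lambda>w. real_of_int (w n)) \<in> borel_measurable \<mu>'"
proof -
  have of_int: "real_of_int \<in> measurable (count_space UNIV) borel" by simp
  show "(\<lambda>w. real_of_int (w n)) \<in> borel_measurable \<mu>"
    by (rule measurable_compose[OF coordinate_measurable'(1)[of "\<lambda>v. v" n] of_int])
  show "(\<lambda>w. real_of_int (w n)) \<in> borel_measurable \<mu>'"
    by (rule measurable_compose[OF coordinate_measurable'(2)[of "\<lambda>v. v" n] of_int])
qed

text \<open>The observables are the vertical and the horizontal step of the curve; their sums along
  \<open>double_step\<close> are displacements, hence bounded on
  \<open>closed_pairs\<close>.\<close>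

lemma abs_mean_le_prob_not_closed:
  "\<bar>\<integral>w. real_of_int (w 0) \<partial>\<mu>\<bar> \<le> P.prob (space (\<mu> \<Otimes>\<^sub>M \<mu>') - closed_pairs)"
  "\<bar>\<integral>u. real_of_int (u 0) \<partial>\<mu>'\<bar> \<le> P.prob (space (\<mu> \<Otimes>\<^sub>M \<mu>') - closed_pairs)"
proof -
  have closed: "closed_pairs \<in> sets (\<mu> \<Otimes>\<^sub>M \<mu>')"
    using closed_pairs_measurable by (simp add: sets_pair)
  have fst_meas: "(\<lambda>x. real_of_int (fst x 0)) \<in> borel_measurable (\<mu> \<Otimes>\<^sub>M \<mu>')"
    by (rule measurable_compose[OF measurable_fst coordinate_borel_measurable(1)])
  have snd_meas: "(\<lambda>x. real_of_int (snd x 0)) \<in> borel_measurable (\<mu> \<Otimes>\<^sub>M \<mu>')"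
    by (rule measurable_compose[OF measurable_snd coordinate_borel_measurable(2)])
  have pm: "\<bar>real_of_int (w n)\<bar> \<le> 1" if "w \<in> Omega_pm" for w n
    using that by (cases rule: Omega_pm_cases[of w n]) auto
  have "(\<integral>w. real_of_int (w 0) \<partial>\<mu>) = (\<integral>w. real_of_int (w 0) \<partial>distr (\<mu> \<Otimes>\<^sub>M \<mu>') \<mu> fst)"
    by (simp add: right.distr_pair_fst)
  also have "\<dots> = (\<integral>x. real_of_int (fst x 0) \<partial>(\<mu> \<Otimes>\<^sub>M \<mu>'))"
    by (intro integral_distr measurable_fst coordinate_borel_measurable)
  also have "\<bar>\<dots>\<bar> \<le> P.prob (space (\<mu> \<Otimes>\<^sub>M \<mu>') - closed_pairs)"
  proof (rule P.abs_expectation_le_if_bounded_sums[OF double_step_preserving fst_meas _ closed])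
    show "\<exists>B. \<forall>k. \<bar>\<Sum>i<k. real_of_int (fst ((double_step ^^ i) x) 0)\<bar> \<le> B" if "x \<in> closed_pairs" for x
      using bounded_displacement(1)[of "fst x" "snd x"] that by simp
  qed (auto simp: double_step_in_closed_pairs_iff space_pair intro: pm)
  finally show "\<bar>\<integral>w. real_of_int (w 0) \<partial>\<mu>\<bar> \<le> P.prob (space (\<mu> \<Otimes>\<^sub>M \<mu>') - closed_pairs)" .
  have "(\<integral>u. real_of_int (u 0) \<partial>\<mu>') = (\<integral>w. real_of_int (w 0) \<partial>distr (\<mu> \<Otimes>\<^sub>M \<mu>') \<mu>' snd)"
    by (simp add: distr_snd)
  \<comment> \<open>The horizontal step is read after the vertical recentring; as
    \<open>column_step\<close> preserves the product measure, its mean is still that of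
    \<open>u 0\<close>.\<close>
  also have "\<dots> = (\<integral>x. real_of_int (snd x 0) \<partial>distr (\<mu> \<Otimes>\<^sub>M \<mu>') (\<mu> \<Otimes>\<^sub>M \<mu>') column_step)"
    unfolding column_step_preserving(2) by (intro integral_distr measurable_snd coordinate_borel_measurable)
  also have "\<dots> = (\<integral>x. real_of_int (snd (column_step x) 0) \<partial>(\<mu> \<Otimes>\<^sub>M \<mu>'))"
    by (intro integral_distr column_step_preserving snd_meas)
  also have "\<bar>\<dots>\<bar> \<le> P.prob (space (\<mu> \<Otimes>\<^sub>M \<mu>') - closed_pairs)"
  proof (rule P.abs_expectation_le_if_bounded_sums[OF double_step_preserving
        measurable_compose[OF column_step_preserving(1) snd_meas] _ closed])
    show "\<exists>B. \<forall>k. \<bar>\<Sum>i<k. real_of_int (snd (column_step ((double_step ^^ i) x)) 0)\<bar> \<le> B"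
      if "x \<in> closed_pairs" for x
      using bounded_displacement(2)[of "fst x" "snd x"] that by simp
    show "\<bar>real_of_int (snd (column_step x) 0)\<bar> \<le> 1" if "x \<in> space (\<mu> \<Otimes>\<^sub>M \<mu>')" for x
      using measurable_space[OF column_step_preserving(1) that] by (intro pm) (auto simp: space_pair)
  qed (simp add: double_step_in_closed_pairs_iff)
  finally show "\<bar>\<integral>u. real_of_int (u 0) \<partial>\<mu>'\<bar> \<le> P.prob (space (\<mu> \<Otimes>\<^sub>M \<mu>') - closed_pairs)" .
qed

text \<open>The event for \<open>e\<close> is the preimage under \<open>T\<close> of an event at the
  origin, hence has the same measure.\<close>

lemma bi_infinite_pairs_via_preserving:
  assumes T: "T \<in> measurable (\<mu> \<Otimes>\<^sub>M \<mu>') (\<mu> \<Otimes>\<^sub>M \<mu>')" "distr (\<mu> \<Otimes>\<^sub>M \<mu>') (\<mu> \<Otimes>\<^sub>M \<mu>') T = \<mu> \<Otimes>\<^sub>M \<mu>'"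
    and bi: "\<And>w u. w \<in> Omega_pm \<Longrightarrow> u \<in> Omega_pm \<Longrightarrow>
      bi_infinite_curve (curve_through (tau w u) e) \<longleftrightarrow> T (w, u) \<notin> closed_pairs"
  shows "bi_infinite_pairs e \<in> sets (\<mu> \<Otimes>\<^sub>M \<mu>')"
    and "measure (\<mu> \<Otimes>\<^sub>M \<mu>') (bi_infinite_pairs e) = P.prob (space (\<mu> \<Otimes>\<^sub>M \<mu>') - closed_pairs)"
proof -
  have eq: "bi_infinite_pairs e = T -` (space (\<mu> \<Otimes>\<^sub>M \<mu>') - closed_pairs) \<inter> space (\<mu> \<Otimes>\<^sub>M \<mu>')"
    using measurable_space[OF T(1)] bi unfolding bi_infinite_pairs_def space_pair by auto
  have sets: "space (\<mu> \<Otimes>\<^sub>M \<mu>') - closed_pairs \<in> sets (\<mu> \<Otimes>\<^sub>M \<mu>')"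
    using closed_pairs_measurable sets_pair by auto
  show "bi_infinite_pairs e \<in> sets (\<mu> \<Otimes>\<^sub>M \<mu>')"
    unfolding eq by (rule measurable_sets[OF T(1) sets])
  show "measure (\<mu> \<Otimes>\<^sub>M \<mu>') (bi_infinite_pairs e) = P.prob (space (\<mu> \<Otimes>\<^sub>M \<mu>') - closed_pairs)"
    using measure_distr[OF T(1) sets] unfolding eq T(2) by simp
qed

text \<open>Recentring at a suitable arc of the curve through \<open>e\<close> moves it to the
  origin. The tile of that arc depends on the direction in which \<open>e\<close> is crossed, so a
  skew product is needed in addition to a fixed shift.\<close>

lemma bi_infinite_pairs_edge:
  assumes e: "e \<in> tiling_edges"
  shows "bi_infinite_pairs e \<in> sets (\<mu> \<Otimes>\<^sub>M \<mu>')"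
    and "measure (\<mu> \<Otimes>\<^sub>M \<mu>') (bi_infinite_pairs e) = P.prob (space (\<mu> \<Otimes>\<^sub>M \<mu>') - closed_pairs)"
proof -
  have "\<exists>T \<in> measurable (\<mu> \<Otimes>\<^sub>M \<mu>') (\<mu> \<Otimes>\<^sub>M \<mu>'). distr (\<mu> \<Otimes>\<^sub>M \<mu>') (\<mu> \<Otimes>\<^sub>M \<mu>') T = \<mu> \<Otimes>\<^sub>M \<mu>' \<and>
    (\<forall>w\<in>Omega_pm. \<forall>u\<in>Omega_pm. bi_infinite_curve (curve_through (tau w u) e) \<longleftrightarrow> T (w, u) \<notin> closed_pairs)"
  proof -
    from e consider (horizontal) m n where "edge_midpoint e = (real_of_int m, real_of_int n - 1/2)"
      | (vertical) m n where "edge_midpoint e = (real_of_int m - 1/2, real_of_int n)"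
      by (auto simp: tiling_edges_def edge_midpoint_closed_segment midpoint_def)
    then show ?thesis
    proof cases
      case horizontal
      \<comment> \<open>\<open>j w\<close> is the row of the tile that is left through
        \<open>e\<close>: below the edge if column \<open>m\<close> runs upwards, above it
        otherwise. This reads \<open>w m\<close> before \<open>w\<close> is shifted, so
        \<open>T1\<close> has to act first.\<close>
      define j where "j w = (if w m = 1 then n - 1 else n)" for w :: "int \<Rightarrow> int"
      define T1 where "T1 = (\<lambda>(w, u). (w :: int \<Rightarrow> int, shift_by (j w) u))"
      define T2 where "T2 = (\<lambda>(w, u). (shift_by m w, u :: int \<Rightarrow> int))"
      have T1: "T1 \<in> measurable (\<mu> \<Otimes>\<^sub>M \<mu>') (\<mu> \<Otimes>\<^sub>M \<mu>')" "distr (\<mu> \<Otimes>\<^sub>M \<mu>') (\<mu> \<Otimes>\<^sub>M \<mu>') T1 = \<mu> \<Otimes>\<^sub>M \<mu>'"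
        unfolding T1_def j_def
        by (rule skew_right[OF coordinate_measurable'(1)[of "\<lambda>v. if v = 1 then n - 1 else n" m]])+
      have T2: "T2 \<in> measurable (\<mu> \<Otimes>\<^sub>M \<mu>') (\<mu> \<Otimes>\<^sub>M \<mu>')" "distr (\<mu> \<Otimes>\<^sub>M \<mu>') (\<mu> \<Otimes>\<^sub>M \<mu>') T2 = \<mu> \<Otimes>\<^sub>M \<mu>'"
        unfolding T2_def using skew_left[of "\<lambda>_. m"] by simp_all
      show ?thesis
      proof (intro bexI[of _ "T2 \<circ> T1"] conjI ballI)
        show "T2 \<circ> T1 \<in> measurable (\<mu> \<Otimes>\<^sub>M \<mu>') (\<mu> \<Otimes>\<^sub>M \<mu>')" by (rule measurable_comp[OF T1(1) T2(1)])
        show "distr (\<mu> \<Otimes>\<^sub>M \<mu>') (\<mu> \<Otimes>\<^sub>M \<mu>') (T2 \<circ> T1) = \<mu> \<Otimes>\<^sub>M \<mu>'"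
          using distr_distr[OF T2(1) T1(1)] by (simp add: T1(2) T2(2))
        fix w u assume wu: "w \<in> Omega_pm" "u \<in> Omega_pm"
        \<comment> \<open>The arc starting on a horizontal edge is entered vertically, whereas
          \<open>closed_pairs\<close> starts from a horizontal entry; hence the step back to its
          predecessor.\<close>
        have "edge_midpoint e = arc_pt w u (next_arc w u (m, j w, True)) 0"
          by (cases rule: Omega_pm_cases[OF wu(1), of m]) (simp_all add: horizontal j_def)
        from bi_infinite_curve_through_iff[OF wu e this]
        have "bi_infinite_curve (curve_through (tau w u) e) \<longleftrightarrow> \<not> periodic w u (m, j w, True)"
          by (simp only: periodic_next_arc_iff)
        then show "bi_infinite_curve (curve_through (tau w u) e) \<longleftrightarrow> (T2 \<circ> T1) (w, u) \<notin> closed_pairs"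
          using wu by (simp add: T1_def T2_def closed_pairs_def shift_by_in_Omega_pm_iff periodic_shift_by)
      qed
    next
      case vertical
      \<comment> \<open>The arc entered through \<open>e\<close> is horizontal already. Its tile
        lies to the right of the edge if row \<open>n\<close> runs to the right, and to the left
        otherwise.\<close>
      define i where "i u = (if u n = 1 then m else m - 1)" for u :: "int \<Rightarrow> int"
      define T1 where "T1 = (\<lambda>(w, u). (shift_by (i u) w, u :: int \<Rightarrow> int))"
      define T2 where "T2 = (\<lambda>(w, u). (w :: int \<Rightarrow> int, shift_by n u))"
      have T1: "T1 \<in> measurable (\<mu> \<Otimes>\<^sub>M \<mu>') (\<mu> \<Otimes>\<^sub>M \<mu>')" "distr (\<mu> \<Otimes>\<^sub>M \<mu>') (\<mu> \<Otimes>\<^sub>M \<mu>') T1 = \<mu> \<Otimes>\<^sub>M \<mu>'"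
        unfolding T1_def i_def
        by (rule skew_left[OF coordinate_measurable'(2)[of "\<lambda>v. if v = 1 then m else m - 1" n]])+
      have T2: "T2 \<in> measurable (\<mu> \<Otimes>\<^sub>M \<mu>') (\<mu> \<Otimes>\<^sub>M \<mu>')" "distr (\<mu> \<Otimes>\<^sub>M \<mu>') (\<mu> \<Otimes>\<^sub>M \<mu>') T2 = \<mu> \<Otimes>\<^sub>M \<mu>'"
        unfolding T2_def using skew_right[of "\<lambda>_. n"] by simp_all
      show ?thesis
      proof (intro bexI[of _ "T2 \<circ> T1"] conjI ballI)
        show "T2 \<circ> T1 \<in> measurable (\<mu> \<Otimes>\<^sub>M \<mu>') (\<mu> \<Otimes>\<^sub>M \<mu>')" by (rule measurable_comp[OF T1(1) T2(1)])
        show "distr (\<mu> \<Otimes>\<^sub>M \<mu>') (\<mu> \<Otimes>\<^sub>M \<mu>') (T2 \<circ> T1) = \<mu> \<Otimes>\<^sub>M \<mu>'"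
          using distr_distr[OF T2(1) T1(1)] by (simp add: T1(2) T2(2))
        fix w u assume wu: "w \<in> Omega_pm" "u \<in> Omega_pm"
        have "edge_midpoint e = arc_pt w u (i u, n, True) 0"
          by (cases rule: Omega_pm_cases[OF wu(2), of n]) (simp_all add: vertical i_def)
        from bi_infinite_curve_through_iff[OF wu e this]
        show "bi_infinite_curve (curve_through (tau w u) e) \<longleftrightarrow> (T2 \<circ> T1) (w, u) \<notin> closed_pairs"
          using wu by (simp add: T1_def T2_def closed_pairs_def shift_by_in_Omega_pm_iff periodic_shift_by)
      qed
    qed
  qed
  then obtain T where T: "T \<in> measurable (\<mu> \<Otimes>\<^sub>M \<mu>') (\<mu> \<Otimes>\<^sub>M \<mu>')"
      "distr (\<mu> \<Otimes>\<^sub>M \<mu>') (\<mu> \<Otimes>\<^sub>M \<mu>') T = \<mu> \<Otimes>\<^sub>M \<mu>'"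
    and bi: "\<And>w u. w \<in> Omega_pm \<Longrightarrow> u \<in> Omega_pm \<Longrightarrow>
        bi_infinite_curve (curve_through (tau w u) e) \<longleftrightarrow> T (w, u) \<notin> closed_pairs"
    by blast
  show "bi_infinite_pairs e \<in> sets (\<mu> \<Otimes>\<^sub>M \<mu>')"
    "measure (\<mu> \<Otimes>\<^sub>M \<mu>') (bi_infinite_pairs e) = P.prob (space (\<mu> \<Otimes>\<^sub>M \<mu>') - closed_pairs)"
    by (rule bi_infinite_pairs_via_preserving[OF T], simp add: bi)+
qed

end

theorem theorem1:
  fixes \<mu> \<mu>' :: "(int \<Rightarrow> int) measure" and p q :: real and e :: "(real \<times> real) set"
  assumes "borel_prob_pm \<mu>" and "shift_invariant \<mu>"
    and "borel_prob_pm \<mu>'" and "shift_invariant \<mu>'"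
    and "p = (\<integral>\<omega>. real_of_int (\<omega> 0) \<partial>\<mu>)"
    and "q = (\<integral>\<omega>'. real_of_int (\<omega>' 0) \<partial>\<mu>')"
    and "e \<in> tiling_edges"
  shows "bi_infinite_pairs e \<in> sets (\<mu> \<Otimes>\<^sub>M \<mu>') \<and>
    measure (\<mu> \<Otimes>\<^sub>M \<mu>') (bi_infinite_pairs e) \<ge> max \<bar>p\<bar> \<bar>q\<bar>"
proof -
  interpret shift_invariant_pair \<mu> \<mu>'
    using assms(1-4) by unfold_locales
  show ?thesis
    unfolding assms(5,6) bi_infinite_pairs_edge(2)[OF assms(7)]
    using bi_infinite_pairs_edge(1)[OF assms(7)] abs_mean_le_prob_not_closed
    by (intro conjI max.boundedI)
qed

end
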